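(* Let $R$ be a commutative ring and $M$ a nonzero $R$-module. (1) If $M$ is a multiplication module, then $M$ is semisecond (resp. second representable) if and only if each nonzero submodule of $M$ is semisecond (resp. second representable). (2) If $M$ is a multiplication module which is not hollow, then $M$ is semisecond (resp. second representable) if and only if each non-small proper submodule of $M$ is semisecond (resp. second representable). (3) If $M$ is second representable with a minimal second representation $M=\sum_{i=1}^nK_i$, then the following conditions are equivalent: (a) $M$ is a multiplication module; (b) $Att^s(M)=att^s(M)=Min(att^s(M))$ and every nonzero submodule of $M$ has a second representation $\sum_{j\in A}K_j$ (that is, equals $\sum_{j\in A}K_j$) for some $A\subseteq\{1,\dots,n\}$. (4) If $M$ is semisimple and second representable, then the following conditions are equivalent: (a) $M$ is a multiplication module; (b) the elements of $att^s(M)$ are (pairwise) incomparable and every second submodule of $M$ is simple. (5) If $M$ is atomic, then the following conditions are equivalent: (a) $M$ is semisimple; (b) $M=\sum_{i\in A}K_i$ for some family of submodules $(K_i)_{i\in A}$ such that for each $i\in A$ there is a prime ideal $p_i$ of $R$ for which every nonzero submodule of $K_i$ is $p_i$-second.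
   Context: Let $R$ be a commutative ring and $M$ a nonzero $R$-module. For $K\le M$, $Ann(K)=\{r\in R\mid rK=0\}$. A submodule $K\le M$ is second if $K\neq 0$ and for every ideal $I\le R$ we have $IK=K$ or $IK=0$; then $p:=Ann(K)$ is a prime ideal and $K$ is called $p$-second. $Att^s(M):=\{Ann(K)\mid K\text{ a second submodule of }M\}$. A module is semisecond if it is a (not necessarily finite) sum of second submodules, and second representable if it is a finite sum $\sum_{i=1}^nK_i$ of second submodules (a second representation). A second representation $M=\sum_{i=1}^nK_i$ is minimal if $Ann(K_i)\neq Ann(K_j)$ for $i\neq j$ and $K_j\nsubseteq\sum_{i\neq j}K_i$ for all $j$. Every second representable module $M$ has a minimal second representation $M=\sum_{i=1}^nK_i$, and $att^s(M):=\{Ann(K_1),\dots,Ann(K_n)\}$, which does not depend on the choice of the minimal second representation. For a set $X$ of ideals, $Min(X)$ is the set of its minimal elements with respect to inclusion. $M$ is a multiplication module if every submodule of $M$ is of the form $IM$ for some ideal $I\le R$. A submodule $N\le M$ is small in $M$ if $N+L\neq M$ for every proper submodule $L\lneq M$; a module is hollow if each of its proper submodules is small in it. $M$ is atomic if every nonzero submodule of $M$ contains a simple submodule, i.e. a minimal element among the nonzero submodules of $M$. *)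

theory Defs
  imports "HOL-Algebra.Module" "HOL-Algebra.Ideal"
begin

text \<open>
  Semisecond and second representable are stated for a submodule \<open>N\<close> of an ambient module \<open>M\<close>; the submodules of
  \<open>N\<close> are the submodules of \<open>M\<close> contained in \<open>N\<close>, and \<open>M\<close> itself is the case \<open>N = carrier M\<close>.
\<close>

definition nonzero_submodule ::
    "('a, 'c) ring_scheme \<Rightarrow> ('a, 'b, 'd) module_scheme \<Rightarrow> 'b set \<Rightarrow> bool" where
  "nonzero_submodule R M N \<longleftrightarrow> submodule N R M \<and> N \<noteq> {\<zero>\<^bsub>M\<^esub>}"

definition proper_submodule ::
    "('a, 'c) ring_scheme \<Rightarrow> ('a, 'b, 'd) module_scheme \<Rightarrow> 'b set \<Rightarrow> bool" where
  "proper_submodule R M N \<longleftrightarrow> submodule N R M \<and> N \<noteq> carrier M"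

definition Ann :: "('a, 'c) ring_scheme \<Rightarrow> ('a, 'b, 'd) module_scheme \<Rightarrow> 'b set \<Rightarrow> 'a set" where
  "Ann R M N = {r \<in> carrier R. \<forall>x\<in>N. r \<odot>\<^bsub>M\<^esub> x = \<zero>\<^bsub>M\<^esub>}"

text \<open>The product \<open>I N\<close>, i.e. all finite sums of elements \<open>a x\<close> with \<open>a \<in> I\<close> and \<open>x \<in> N\<close>.\<close>

definition ideal_smult :: "('a, 'b, 'd) module_scheme \<Rightarrow> 'a set \<Rightarrow> 'b set \<Rightarrow> 'b set" where
  "ideal_smult M I N =
     {(\<Oplus>\<^bsub>M\<^esub>k\<in>{..<n}. a k \<odot>\<^bsub>M\<^esub> x k) | (n::nat) a x. (\<forall>k<n. a k \<in> I) \<and> (\<forall>k<n. x k \<in> N)}"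

text \<open>
  The sum of a possibly infinite family of submodules; the empty sum is the zero submodule.
  For a set of submodules the family is the identity, as repetitions do not change the sum.
\<close>

definition submodule_sum :: "('a, 'b, 'd) module_scheme \<Rightarrow> ('i \<Rightarrow> 'b set) \<Rightarrow> 'i set \<Rightarrow> 'b set" where
  "submodule_sum M K A =
     {(\<Oplus>\<^bsub>M\<^esub>i\<in>F. x i) | F x. finite F \<and> F \<subseteq> A \<and> (\<forall>i\<in>F. x i \<in> K i)}"

definition second_submodule ::
    "('a, 'c) ring_scheme \<Rightarrow> ('a, 'b, 'd) module_scheme \<Rightarrow> 'b set \<Rightarrow> bool" where
  "second_submodule R M K \<longleftrightarrow> nonzero_submodule R M K \<and>
     (\<forall>I. ideal I R \<longrightarrow> ideal_smult M I K = K \<or> ideal_smult M I K = {\<zero>\<^bsub>M\<^esub>})"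

definition p_second ::
    "('a, 'c) ring_scheme \<Rightarrow> ('a, 'b, 'd) module_scheme \<Rightarrow> 'a set \<Rightarrow> 'b set \<Rightarrow> bool" where
  "p_second R M p K \<longleftrightarrow> second_submodule R M K \<and> Ann R M K = p"

text \<open>\<open>Att\<^sup>s(M)\<close>, as opposed to \<open>att\<^sup>s(M)\<close> below.\<close>

definition Att_second :: "('a, 'c) ring_scheme \<Rightarrow> ('a, 'b, 'd) module_scheme \<Rightarrow> 'a set set" where
  "Att_second R M = {Ann R M K | K. second_submodule R M K}"

definition semisecond ::
    "('a, 'c) ring_scheme \<Rightarrow> ('a, 'b, 'd) module_scheme \<Rightarrow> 'b set \<Rightarrow> bool" where
  "semisecond R M N \<longleftrightarrow>
     (\<exists>\<K>. (\<forall>K\<in>\<K>. second_submodule R M K) \<and> N = submodule_sum M (\<lambda>K. K) \<K>)"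

definition second_representation ::
    "('a, 'c) ring_scheme \<Rightarrow> ('a, 'b, 'd) module_scheme \<Rightarrow> 'b set \<Rightarrow> nat \<Rightarrow> (nat \<Rightarrow> 'b set) \<Rightarrow> bool" where
  "second_representation R M N n K \<longleftrightarrow>
     (\<forall>i\<in>{1..n}. second_submodule R M (K i)) \<and> N = submodule_sum M K {1..n}"

definition second_representable ::
    "('a, 'c) ring_scheme \<Rightarrow> ('a, 'b, 'd) module_scheme \<Rightarrow> 'b set \<Rightarrow> bool" where
  "second_representable R M N \<longleftrightarrow> (\<exists>n K. second_representation R M N n K)"

definition minimal_second_representation ::
    "('a, 'c) ring_scheme \<Rightarrow> ('a, 'b, 'd) module_scheme \<Rightarrow> 'b set \<Rightarrow> nat \<Rightarrow> (nat \<Rightarrow> 'b set) \<Rightarrow> bool" where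
  "minimal_second_representation R M N n K \<longleftrightarrow>
     second_representation R M N n K \<and>
     (\<forall>i\<in>{1..n}. \<forall>j\<in>{1..n}. i \<noteq> j \<longrightarrow> Ann R M (K i) \<noteq> Ann R M (K j)) \<and>
     (\<forall>j\<in>{1..n}. \<not> K j \<subseteq> submodule_sum M K ({1..n} - {j}))"

text \<open>
  \<open>att\<^sup>s(M)\<close>: the annihilators occurring in a minimal second representation of \<open>M\<close>. The definite
  description is justified when \<open>M\<close> is second representable, since this set then exists and does
  not depend on the chosen minimal second representation; otherwise the value is unspecified.
\<close>

definition att_second :: "('a, 'c) ring_scheme \<Rightarrow> ('a, 'b, 'd) module_scheme \<Rightarrow> 'a set set" where
  "att_second R M =
     (THE P. \<exists>n K. minimal_second_representation R M (carrier M) n K \<and>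
                   P = (\<lambda>i. Ann R M (K i)) ` {1..n})"

definition minimal_elements :: "'a set set \<Rightarrow> 'a set set" where
  "minimal_elements X = {I \<in> X. \<forall>J\<in>X. J \<subseteq> I \<longrightarrow> J = I}"

definition multiplication_module ::
    "('a, 'c) ring_scheme \<Rightarrow> ('a, 'b, 'd) module_scheme \<Rightarrow> bool" where
  "multiplication_module R M \<longleftrightarrow>
     (\<forall>N. submodule N R M \<longrightarrow> (\<exists>I. ideal I R \<and> N = ideal_smult M I (carrier M)))"

definition small_submodule ::
    "('a, 'c) ring_scheme \<Rightarrow> ('a, 'b, 'd) module_scheme \<Rightarrow> 'b set \<Rightarrow> bool" where
  "small_submodule R M N \<longleftrightarrow> submodule N R M \<and>
     (\<forall>L. proper_submodule R M L \<longrightarrow> N <+>\<^bsub>M\<^esub> L \<noteq> carrier M)"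

definition hollow_module ::
    "('a, 'c) ring_scheme \<Rightarrow> ('a, 'b, 'd) module_scheme \<Rightarrow> bool" where
  "hollow_module R M \<longleftrightarrow> (\<forall>N. proper_submodule R M N \<longrightarrow> small_submodule R M N)"

definition simple_submodule ::
    "('a, 'c) ring_scheme \<Rightarrow> ('a, 'b, 'd) module_scheme \<Rightarrow> 'b set \<Rightarrow> bool" where
  "simple_submodule R M S \<longleftrightarrow> nonzero_submodule R M S \<and>
     (\<forall>N. nonzero_submodule R M N \<and> N \<subseteq> S \<longrightarrow> N = S)"

definition semisimple_module ::
    "('a, 'c) ring_scheme \<Rightarrow> ('a, 'b, 'd) module_scheme \<Rightarrow> bool" where
  "semisimple_module R M \<longleftrightarrow>
     (\<exists>\<S>. (\<forall>S\<in>\<S>. simple_submodule R M S) \<and> carrier M = submodule_sum M (\<lambda>S. S) \<S>)"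

definition atomic_module ::
    "('a, 'c) ring_scheme \<Rightarrow> ('a, 'b, 'd) module_scheme \<Rightarrow> bool" where
  "atomic_module R M \<longleftrightarrow>
     (\<forall>N. nonzero_submodule R M N \<longrightarrow> (\<exists>S. simple_submodule R M S \<and> S \<subseteq> N))"

end

theory Submission
  imports Defs
begin

text \<open>
  Multiplication by an ideal \<open>I\<close> commutes with sums of submodules, and it sends a second submodule
  \<open>K\<close> to \<open>0\<close> or \<open>K\<close> according to whether \<open>I\<close> annihilates \<open>K\<close>. Hence, if \<open>M\<close> is the sum of second
  submodules \<open>K\<^sub>i\<close>, then \<open>I M\<close> is the sum of those \<open>K\<^sub>i\<close> that \<open>I\<close> does not annihilate
  (\<open>ideal_smult_sum_of_seconds\<close>). In a multiplication module every submodule is therefore a subsum of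
  any given sum of second submodules, so that semisecond and second representable multiplication
  modules pass these properties on to their submodules. In the other direction, a module that is not
  hollow is the sum of two proper non-small submodules, whose representations combine.

  Let \<open>M\<close> be the sum of a minimal family \<open>K\<^sub>1, \<dots>, K\<^sub>n\<close>. The primes \<open>Ann K\<^sub>i\<close> are exactly the
  prime ideals of the form \<open>(L : M)\<close> with \<open>L\<close> a submodule (\<open>Ann_irredundant_second_sum\<close>), so they do
  not depend on the family and \<open>att\<^sup>s(M)\<close> is well defined. If \<open>M\<close> is a multiplication module, then
  \<open>K\<^sub>j = I M\<close> contains every \<open>K\<^sub>i\<close> with \<open>Ann K\<^sub>i \<subseteq> Ann K\<^sub>j\<close>, and minimality leaves only \<open>i = j\<close>: the
  primes are incomparable. A second submodule is then a subsum whose annihilator, being prime, is one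
  of the \<open>Ann K\<^sub>i\<close> involved, and incomparability reduces the subsum to a single \<open>K\<^sub>i\<close>. So the second
  submodules are precisely \<open>K\<^sub>1, \<dots>, K\<^sub>n\<close>. Conversely, if the primes are incomparable, there is for
  every set \<open>B\<close> of indices an ideal that kills exactly the summands outside \<open>B\<close>, so that every subsum
  has the form \<open>I M\<close>.

  A second submodule \<open>L\<close> of a semisimple module contains a simple one, which is second as well. In a
  multiplication module both are among the \<open>K\<^sub>i\<close>, and nested \<open>K\<^sub>i\<close> coincide, so \<open>L\<close> is simple.
  Conversely, if the \<open>K\<^sub>i\<close> are simple with incomparable annihilators, a scalar that kills all summands
  but one extracts the components of an element, so every submodule is a subsum and the previous
  criterion applies.

  Finally, if all nonzero submodules of \<open>K\<close> have annihilator \<open>p\<close> and one of them is simple, then \<open>p\<close>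
  is maximal and \<open>K\<close> is a vector space over \<open>R/p\<close>, in which every nonzero element generates a simple
  submodule. This makes an atomic sum of such modules semisimple.
\<close>

context module
begin

section \<open>Sums of submodules and products with ideals\<close>

lemma submodule_zero_mem: "submodule N R M \<Longrightarrow> \<zero>\<^bsub>M\<^esub> \<in> N"
  using subgroup.one_closed[OF submodule.axioms(1), of N R M] by simp

lemma zero_submodule: "submodule {\<zero>\<^bsub>M\<^esub>} R M"
  by (rule submoduleI) auto

lemma submodule_finsum:
  assumes "submodule N R M" "finite F" "\<And>i. i \<in> F \<Longrightarrow> x i \<in> N"
  shows "(\<Oplus>\<^bsub>M\<^esub>i\<in>F. x i) \<in> N"
  using assms(2,3)
proof (induction F rule: finite_induct)
  case empty
  then show ?case using submodule_zero_mem[OF assms(1)] by simp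
next
  case (insert i F)
  then have "x i \<in> carrier M" "x \<in> F \<rightarrow> carrier M"
    using submoduleE(1)[OF assms(1)] by auto
  with insert show ?case using submoduleE(5)[OF assms(1)] by simp
qed

text \<open>
  Together with \<open>submodule_sum_upper\<close> and \<open>submodule_sum_submodule\<close> this makes the sum the least upper
  bound in the lattice of submodules, so that most identities between sums follow from inclusions of
  the summands.
\<close>

lemma submodule_sum_least:
  assumes "submodule N R M" "\<And>i. i \<in> A \<Longrightarrow> K i \<subseteq> N"
  shows "submodule_sum M K A \<subseteq> N"
proof
  fix y assume "y \<in> submodule_sum M K A"
  then obtain F x where F: "finite F" "F \<subseteq> A" "\<forall>i\<in>F. x i \<in> K i" and y: "y = (\<Oplus>\<^bsub>M\<^esub>i\<in>F. x i)"
    unfolding submodule_sum_def by blast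
  show "y \<in> N" unfolding y using F assms(2) by (intro submodule_finsum[OF assms(1)]) auto
qed

lemma submodule_sum_upper:
  assumes "i \<in> A" "K i \<subseteq> carrier M"
  shows "K i \<subseteq> submodule_sum M K A"
proof
  fix x assume x: "x \<in> K i"
  then have "x \<in> carrier M" using assms by blast
  then have "(\<Oplus>\<^bsub>M\<^esub>j\<in>{i}. x) = x" by simp
  then show "x \<in> submodule_sum M K A"
    unfolding submodule_sum_def using assms(1) x
    by (intro CollectI exI[of _ "{i}"] exI[of _ "\<lambda>_. x"]) auto
qed

lemma submodule_sum_submodule:
  assumes K: "\<And>i. i \<in> A \<Longrightarrow> submodule (K i) R M"
  shows "submodule (submodule_sum M K A) R M"
proof -
  have sub: "K i \<subseteq> carrier M" if "i \<in> A" for i using submoduleE(1)[OF K[OF that]] .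
  have smult: "a \<odot>\<^bsub>M\<^esub> x \<in> submodule_sum M K A"
    if a: "a \<in> carrier R" and x: "x \<in> submodule_sum M K A" for a x
  proof -
    obtain F f where f: "finite F" "F \<subseteq> A" "\<forall>i\<in>F. f i \<in> K i" "x = (\<Oplus>\<^bsub>M\<^esub>i\<in>F. f i)"
      using x unfolding submodule_sum_def by blast
    have "f \<in> F \<rightarrow> carrier M" using f sub by blast
    then have "a \<odot>\<^bsub>M\<^esub> x = (\<Oplus>\<^bsub>M\<^esub>i\<in>F. a \<odot>\<^bsub>M\<^esub> f i)"
      using f a finsum_smult_ldistr by simp
    moreover have "\<forall>i\<in>F. a \<odot>\<^bsub>M\<^esub> f i \<in> K i" using f a submoduleE(4)[OF K] by blast
    ultimately show ?thesis unfolding submodule_sum_def using f by blast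
  qed
  have carr: "submodule_sum M K A \<subseteq> carrier M"
    by (rule submodule_sum_least[OF carrier_is_submodule sub])
  show ?thesis
  proof (rule submoduleI[OF carr])
    show "\<zero>\<^bsub>M\<^esub> \<in> submodule_sum M K A"
      unfolding submodule_sum_def by (intro CollectI exI[of _ "{}"]) auto
    show "a \<odot>\<^bsub>M\<^esub> x \<in> submodule_sum M K A"
      if "a \<in> carrier R" "x \<in> submodule_sum M K A" for a x using smult that .
    show "\<ominus>\<^bsub>M\<^esub> x \<in> submodule_sum M K A" if x: "x \<in> submodule_sum M K A" for x
      using smult[of "\<ominus>\<^bsub>R\<^esub> \<one>\<^bsub>R\<^esub>", OF _ x] smult_l_minus[of "\<one>\<^bsub>R\<^esub>" x] x carr by auto
    show "x \<oplus>\<^bsub>M\<^esub> y \<in> submodule_sum M K A"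
      if x: "x \<in> submodule_sum M K A" and y: "y \<in> submodule_sum M K A" for x y
    proof -
      obtain F f where f: "finite F" "F \<subseteq> A" "\<forall>i\<in>F. f i \<in> K i" "x = (\<Oplus>\<^bsub>M\<^esub>i\<in>F. f i)"
        using x unfolding submodule_sum_def by blast
      obtain G g where g: "finite G" "G \<subseteq> A" "\<forall>i\<in>G. g i \<in> K i" "y = (\<Oplus>\<^bsub>M\<^esub>i\<in>G. g i)"
        using y unfolding submodule_sum_def by blast
      \<comment> \<open>The two families are extended by zero to the common index set \<open>F \<union> G\<close>.\<close>
      define f' where "f' = (\<lambda>i. if i \<in> F then f i else \<zero>\<^bsub>M\<^esub>)"
      define g' where "g' = (\<lambda>i. if i \<in> G then g i else \<zero>\<^bsub>M\<^esub>)"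
      have K': "f' i \<in> K i" "g' i \<in> K i" if "i \<in> F \<union> G" for i
        using that f g submodule_zero_mem[OF K] unfolding f'_def g'_def by auto
      have carr': "f' \<in> F \<union> G \<rightarrow> carrier M" "g' \<in> F \<union> G \<rightarrow> carrier M"
        using K' sub f(2) g(2) by blast+
      have "x = (\<Oplus>\<^bsub>M\<^esub>i\<in>F \<union> G. f' i)" unfolding f(4)
        using carr' f(1) g(1)
        by (intro M.add.finprod_mono_neutral_cong_left) (auto simp: f'_def)
      moreover have "y = (\<Oplus>\<^bsub>M\<^esub>i\<in>F \<union> G. g' i)" unfolding g(4)
        using carr' f(1) g(1)
        by (intro M.add.finprod_mono_neutral_cong_left) (auto simp: g'_def)
      ultimately have "x \<oplus>\<^bsub>M\<^esub> y = (\<Oplus>\<^bsub>M\<^esub>i\<in>F \<union> G. f' i \<oplus>\<^bsub>M\<^esub> g' i)"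
        using M.finsum_addf[OF carr'] by simp
      moreover have "\<forall>i\<in>F \<union> G. f' i \<oplus>\<^bsub>M\<^esub> g' i \<in> K i"
        using K' f(2) g(2) submoduleE(5)[OF K] by blast
      ultimately show ?thesis unfolding submodule_sum_def
        using f g by (intro CollectI exI[of _ "F \<union> G"] exI[of _ "\<lambda>i. f' i \<oplus>\<^bsub>M\<^esub> g' i"]) auto
    qed
  qed
qed

lemma submodule_sum_image:
  assumes "\<And>i. i \<in> A \<Longrightarrow> submodule (K i) R M"
  shows "submodule_sum M (\<lambda>N. N) (K ` A) = submodule_sum M K A"
proof (rule equalityI)
  have K: "K i \<subseteq> carrier M" if "i \<in> A" for i using submoduleE(1)[OF assms[OF that]] .
  have "K i \<subseteq> submodule_sum M K A" if "i \<in> A" for i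
    using submodule_sum_upper[where K = K, OF that K[OF that]] .
  then show "submodule_sum M (\<lambda>N. N) (K ` A) \<subseteq> submodule_sum M K A"
    by (intro submodule_sum_least[OF submodule_sum_submodule[OF assms]]) auto
  have "submodule (submodule_sum M (\<lambda>N. N) (K ` A)) R M"
    using assms by (intro submodule_sum_submodule) auto
  moreover have "K i \<subseteq> submodule_sum M (\<lambda>N. N) (K ` A)" if "i \<in> A" for i
    using submodule_sum_upper[where K = "\<lambda>N. N" and i = "K i" and A = "K ` A"] K that by simp
  ultimately show "submodule_sum M K A \<subseteq> submodule_sum M (\<lambda>N. N) (K ` A)"
    by (intro submodule_sum_least)
qed

lemma submodule_sum_empty: "submodule_sum M K {} = {\<zero>\<^bsub>M\<^esub>}"
  unfolding submodule_sum_def by auto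

lemma submodule_sum_singleton:
  assumes "submodule (K i) R M"
  shows "submodule_sum M K {i} = K i"
proof (rule equalityI)
  show "submodule_sum M K {i} \<subseteq> K i" by (rule submodule_sum_least[OF assms]) auto
  show "K i \<subseteq> submodule_sum M K {i}"
    by (rule submodule_sum_upper) (use submoduleE(1)[OF assms] in auto)
qed

lemma submodule_sum_mono: "A \<subseteq> B \<Longrightarrow> submodule_sum M K A \<subseteq> submodule_sum M K B"
  unfolding submodule_sum_def by blast

lemma submodule_sum_drop_zero:
  assumes "\<And>i. i \<in> A \<Longrightarrow> submodule (K i) R M"
  shows "submodule_sum M (\<lambda>i. if i \<in> B then K i else {\<zero>\<^bsub>M\<^esub>}) A = submodule_sum M K (A \<inter> B)"
    (is "submodule_sum M ?K' A = _")
proof (rule equalityI)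
  have S: "submodule (submodule_sum M K (A \<inter> B)) R M"
    using assms by (intro submodule_sum_submodule) auto
  have "?K' i \<subseteq> submodule_sum M K (A \<inter> B)" if "i \<in> A" for i
    using submodule_sum_upper[where K = K and i = i and A = "A \<inter> B"] that
      submoduleE(1)[OF assms[OF that]] submodule_zero_mem[OF S] by auto
  then show "submodule_sum M ?K' A \<subseteq> submodule_sum M K (A \<inter> B)"
    by (intro submodule_sum_least[OF S])
  have K': "submodule (?K' i) R M" if "i \<in> A" for i using assms[OF that] zero_submodule by simp
  have "K i \<subseteq> submodule_sum M ?K' A" if "i \<in> A \<inter> B" for i
    using submodule_sum_upper[where K = ?K' and i = i and A = A] that submoduleE(1)[OF assms] by auto
  then show "submodule_sum M K (A \<inter> B) \<subseteq> submodule_sum M ?K' A"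
    by (intro submodule_sum_least[OF submodule_sum_submodule[OF K']])
qed

lemma ideal_smult_least:
  assumes "submodule N R M" "\<And>a x. a \<in> I \<Longrightarrow> x \<in> L \<Longrightarrow> a \<odot>\<^bsub>M\<^esub> x \<in> N"
  shows "ideal_smult M I L \<subseteq> N"
proof
  fix y assume "y \<in> ideal_smult M I L"
  then obtain n a x where ax: "\<forall>k<n::nat. a k \<in> I" "\<forall>k<n. x k \<in> L"
    and y: "y = (\<Oplus>\<^bsub>M\<^esub>k\<in>{..<n}. a k \<odot>\<^bsub>M\<^esub> x k)"
    unfolding ideal_smult_def by blast
  show "y \<in> N" unfolding y using ax assms(2) by (intro submodule_finsum[OF assms(1)]) auto
qed

lemma ideal_smult_mem:
  assumes "I \<subseteq> carrier R" "L \<subseteq> carrier M" "a \<in> I" "x \<in> L"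
  shows "a \<odot>\<^bsub>M\<^esub> x \<in> ideal_smult M I L"
proof -
  have "a \<in> carrier R" "x \<in> carrier M" using assms by blast+
  then have "(\<Oplus>\<^bsub>M\<^esub>k\<in>{..<1::nat}. a \<odot>\<^bsub>M\<^esub> x) = a \<odot>\<^bsub>M\<^esub> x"
    by (simp add: lessThan_Suc)
  then show ?thesis unfolding ideal_smult_def using assms(3,4)
    by (intro CollectI exI[of _ "1::nat"] exI[of _ "\<lambda>_. a"] exI[of _ "\<lambda>_. x"]) auto
qed

lemma ideal_smult_submodule:
  assumes I: "ideal I R" and L: "submodule L R M"
  shows "submodule (ideal_smult M I L) R M"
proof -
  have IR: "I \<subseteq> carrier R" using ideal.Icarr[OF I] by blast
  have LM: "L \<subseteq> carrier M" using submoduleE(1)[OF L] .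
  have carr: "ideal_smult M I L \<subseteq> carrier M"
    using IR LM by (intro ideal_smult_least[OF carrier_is_submodule]) auto
  have zero: "\<zero>\<^bsub>M\<^esub> \<in> ideal_smult M I L"
    unfolding ideal_smult_def by (intro CollectI exI[of _ "0::nat"]) auto
  have step: "t \<oplus>\<^bsub>M\<^esub> c \<odot>\<^bsub>M\<^esub> z \<in> ideal_smult M I L"
    if t: "t \<in> ideal_smult M I L" and c: "c \<in> I" and z: "z \<in> L" for t c z
  proof -
    obtain n a x where ax: "\<forall>k<n::nat. a k \<in> I" "\<forall>k<n. x k \<in> L"
      and teq: "t = (\<Oplus>\<^bsub>M\<^esub>k\<in>{..<n}. a k \<odot>\<^bsub>M\<^esub> x k)"
      using t unfolding ideal_smult_def by blast
    define a' where "a' = a(n := c)"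
    define x' where "x' = x(n := z)"
    have in_carr: "(\<lambda>k. a' k \<odot>\<^bsub>M\<^esub> x' k) \<in> {..<n} \<rightarrow> carrier M"
      using ax IR LM unfolding a'_def x'_def by (auto simp: subset_iff)
    have cz: "c \<odot>\<^bsub>M\<^esub> z \<in> carrier M" using c z IR LM by auto
    have "t = (\<Oplus>\<^bsub>M\<^esub>k\<in>{..<n}. a' k \<odot>\<^bsub>M\<^esub> x' k)"
      unfolding teq using in_carr
      by (intro M.finsum_cong') (auto simp: a'_def x'_def)
    then have "t \<oplus>\<^bsub>M\<^esub> c \<odot>\<^bsub>M\<^esub> z = (\<Oplus>\<^bsub>M\<^esub>k\<in>{..<Suc n}. a' k \<odot>\<^bsub>M\<^esub> x' k)"
      using M.finsum_insert[of "{..<n}" n "\<lambda>k. a' k \<odot>\<^bsub>M\<^esub> x' k"] in_carr cz carr t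
      by (auto simp: lessThan_Suc a'_def x'_def M.a_comm)
    moreover have "\<forall>k<Suc n. a' k \<in> I" "\<forall>k<Suc n. x' k \<in> L"
      using ax c z unfolding a'_def x'_def by (auto simp: less_Suc_eq)
    ultimately show ?thesis unfolding ideal_smult_def by blast
  qed
  have smult: "r \<odot>\<^bsub>M\<^esub> t \<in> ideal_smult M I L"
    if r: "r \<in> carrier R" and t: "t \<in> ideal_smult M I L" for r t
  proof -
    obtain n a x where ax: "\<forall>k<n::nat. a k \<in> I" "\<forall>k<n. x k \<in> L"
      and teq: "t = (\<Oplus>\<^bsub>M\<^esub>k\<in>{..<n}. a k \<odot>\<^bsub>M\<^esub> x k)"
      using t unfolding ideal_smult_def by blast
    have "r \<odot>\<^bsub>M\<^esub> t = (\<Oplus>\<^bsub>M\<^esub>k\<in>{..<n}. r \<odot>\<^bsub>M\<^esub> (a k \<odot>\<^bsub>M\<^esub> x k))"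
      unfolding teq using ax IR LM r by (intro finsum_smult_ldistr) (auto simp: subset_iff)
    also have "\<dots> = (\<Oplus>\<^bsub>M\<^esub>k\<in>{..<n}. a k \<odot>\<^bsub>M\<^esub> (r \<odot>\<^bsub>M\<^esub> x k))"
    proof (rule M.finsum_cong')
      show "(\<lambda>k. a k \<odot>\<^bsub>M\<^esub> (r \<odot>\<^bsub>M\<^esub> x k)) \<in> {..<n} \<rightarrow> carrier M"
        using ax IR LM r by (auto simp: subset_iff)
      show "r \<odot>\<^bsub>M\<^esub> (a k \<odot>\<^bsub>M\<^esub> x k) = a k \<odot>\<^bsub>M\<^esub> (r \<odot>\<^bsub>M\<^esub> x k)" if "k \<in> {..<n}" for k
      proof -
        have "a k \<in> carrier R" "x k \<in> carrier M" using that ax IR LM by (auto simp: subset_iff)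
        then show ?thesis using r by (metis smult_assoc1 R.m_comm)
      qed
    qed simp
    finally show ?thesis unfolding ideal_smult_def
      using ax(1) ax(2) submoduleE(4)[OF L r]
      by (intro CollectI exI[of _ n] exI[of _ a] exI[of _ "\<lambda>k. r \<odot>\<^bsub>M\<^esub> x k"]) auto
  qed
  show ?thesis
  proof (rule submoduleI[OF carr zero])
    show "r \<odot>\<^bsub>M\<^esub> t \<in> ideal_smult M I L"
      if "r \<in> carrier R" "t \<in> ideal_smult M I L" for r t using smult that .
    show "\<ominus>\<^bsub>M\<^esub> t \<in> ideal_smult M I L" if t: "t \<in> ideal_smult M I L" for t
      using smult[of "\<ominus>\<^bsub>R\<^esub> \<one>\<^bsub>R\<^esub>", OF _ t] smult_l_minus[of "\<one>\<^bsub>R\<^esub>" t] t carr by auto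
    show "s \<oplus>\<^bsub>M\<^esub> t \<in> ideal_smult M I L"
      if s: "s \<in> ideal_smult M I L" and t: "t \<in> ideal_smult M I L" for s t
    proof -
      obtain n a x where ax: "\<forall>k<n::nat. a k \<in> I" "\<forall>k<n. x k \<in> L"
        and teq: "t = (\<Oplus>\<^bsub>M\<^esub>k\<in>{..<n}. a k \<odot>\<^bsub>M\<^esub> x k)"
        using t unfolding ideal_smult_def by blast
      have in_carr: "a k \<odot>\<^bsub>M\<^esub> x k \<in> carrier M" if "k < n" for k
        using ax IR LM that by (auto simp: subset_iff)
      have sM: "s \<in> carrier M" using s carr by auto
      have "s \<oplus>\<^bsub>M\<^esub> (\<Oplus>\<^bsub>M\<^esub>k\<in>{..<m}. a k \<odot>\<^bsub>M\<^esub> x k) \<in> ideal_smult M I L" if "m \<le> n" for m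
        using that
      proof (induction m)
        case 0
        then show ?case using s sM by simp
      next
        case (Suc m)
        let ?S = "\<Oplus>\<^bsub>M\<^esub>k\<in>{..<m}. a k \<odot>\<^bsub>M\<^esub> x k"
        have fam: "(\<lambda>k. a k \<odot>\<^bsub>M\<^esub> x k) \<in> {..<m} \<rightarrow> carrier M"
          using in_carr Suc.prems by auto
        have S: "?S \<in> carrier M" using M.finsum_closed[OF fam] .
        have last: "a m \<odot>\<^bsub>M\<^esub> x m \<in> carrier M" using in_carr Suc.prems by auto
        have "(\<Oplus>\<^bsub>M\<^esub>k\<in>{..<Suc m}. a k \<odot>\<^bsub>M\<^esub> x k) = ?S \<oplus>\<^bsub>M\<^esub> a m \<odot>\<^bsub>M\<^esub> x m"
          using M.finsum_insert[of "{..<m}" m "\<lambda>k. a k \<odot>\<^bsub>M\<^esub> x k"] fam last S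
          by (simp add: lessThan_Suc M.a_comm)
        then have "s \<oplus>\<^bsub>M\<^esub> (\<Oplus>\<^bsub>M\<^esub>k\<in>{..<Suc m}. a k \<odot>\<^bsub>M\<^esub> x k)
            = (s \<oplus>\<^bsub>M\<^esub> ?S) \<oplus>\<^bsub>M\<^esub> a m \<odot>\<^bsub>M\<^esub> x m"
          using sM S last by (simp add: M.a_assoc)
        then show ?case using step Suc ax by simp
      qed
      then show ?thesis unfolding teq by blast
    qed
  qed
qed

lemma ideal_smult_subset:
  assumes "ideal I R" "submodule L R M"
  shows "ideal_smult M I L \<subseteq> L"
  using submoduleE(4)[OF assms(2)] ideal.Icarr[OF assms(1)]
  by (intro ideal_smult_least[OF assms(2)]) blast

text \<open>
  Used to test on generators: to show that \<open>I\<close> carries a sum of submodules into \<open>N\<close>, it suffices that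
  each summand lies in this submodule.
\<close>

lemma transporter_submodule:
  assumes N: "submodule N R M" and I: "I \<subseteq> carrier R"
  shows "submodule {x \<in> carrier M. \<forall>a\<in>I. a \<odot>\<^bsub>M\<^esub> x \<in> N} R M"
proof (rule submoduleI)
  fix r x
  assume r: "r \<in> carrier R" and x: "x \<in> {x \<in> carrier M. \<forall>a\<in>I. a \<odot>\<^bsub>M\<^esub> x \<in> N}"
  have "a \<odot>\<^bsub>M\<^esub> (r \<odot>\<^bsub>M\<^esub> x) \<in> N" if a: "a \<in> I" for a
  proof -
    have "a \<odot>\<^bsub>M\<^esub> (r \<odot>\<^bsub>M\<^esub> x) = r \<odot>\<^bsub>M\<^esub> (a \<odot>\<^bsub>M\<^esub> x)"
      using r x a I by (metis (no_types, lifting) smult_assoc1 R.m_comm mem_Collect_eq subsetD)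
    then show ?thesis using submoduleE(4)[OF N r] x a by auto
  qed
  then show "r \<odot>\<^bsub>M\<^esub> x \<in> {x \<in> carrier M. \<forall>a\<in>I. a \<odot>\<^bsub>M\<^esub> x \<in> N}" using r x by auto
next
  fix x y
  assume "x \<in> {x \<in> carrier M. \<forall>a\<in>I. a \<odot>\<^bsub>M\<^esub> x \<in> N}" "y \<in> {x \<in> carrier M. \<forall>a\<in>I. a \<odot>\<^bsub>M\<^esub> x \<in> N}"
  then show "x \<oplus>\<^bsub>M\<^esub> y \<in> {x \<in> carrier M. \<forall>a\<in>I. a \<odot>\<^bsub>M\<^esub> x \<in> N}"
    using I submoduleE(5)[OF N] by (auto simp: subset_iff smult_r_distr)
next
  fix x assume "x \<in> {x \<in> carrier M. \<forall>a\<in>I. a \<odot>\<^bsub>M\<^esub> x \<in> N}"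
  then show "\<ominus>\<^bsub>M\<^esub> x \<in> {x \<in> carrier M. \<forall>a\<in>I. a \<odot>\<^bsub>M\<^esub> x \<in> N}"
    using I submoduleE(3)[OF N] by (auto simp: subset_iff smult_r_minus)
qed (use I submodule_zero_mem[OF N] in \<open>auto simp: subset_iff\<close>)

lemma colon_ideal:
  assumes N: "submodule N R M" and L: "L \<subseteq> carrier M"
  shows "ideal {r \<in> carrier R. \<forall>x\<in>L. r \<odot>\<^bsub>M\<^esub> x \<in> N} R" (is "ideal ?C R")
proof (rule idealI[OF R.ring_axioms])
  show "subgroup ?C (add_monoid R)"
  proof (rule R.add.subgroupI)
    show "?C \<noteq> {}" using L submodule_zero_mem[OF N] by (auto intro!: exI[of _ "\<zero>\<^bsub>R\<^esub>"])
    show "\<And>a. a \<in> ?C \<Longrightarrow> \<ominus>\<^bsub>R\<^esub> a \<in> ?C"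
      using L submoduleE(3)[OF N] by (auto simp: subset_iff smult_l_minus)
    show "\<And>a b. \<lbrakk>a \<in> ?C; b \<in> ?C\<rbrakk> \<Longrightarrow> a \<oplus>\<^bsub>R\<^esub> b \<in> ?C"
      using L submoduleE(5)[OF N] by (auto simp: subset_iff smult_l_distr)
  qed auto
  fix a r assume a: "a \<in> ?C" and r: "r \<in> carrier R"
  show "r \<otimes>\<^bsub>R\<^esub> a \<in> ?C"
    using a r L submoduleE(4)[OF N] by (auto simp: subset_iff smult_assoc1)
  then show "a \<otimes>\<^bsub>R\<^esub> r \<in> ?C" using a r by (simp add: R.m_comm)
qed

lemma Ann_ideal: "L \<subseteq> carrier M \<Longrightarrow> ideal (Ann R M L) R"
  using colon_ideal[OF zero_submodule, of L] unfolding Ann_def by simp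

lemma Ann_antimono: "K \<subseteq> L \<Longrightarrow> Ann R M L \<subseteq> Ann R M K"
  unfolding Ann_def by auto

lemma Ann_submodule_sum:
  assumes K: "\<And>i. i \<in> A \<Longrightarrow> submodule (K i) R M"
  shows "Ann R M (submodule_sum M K A) = {r \<in> carrier R. \<forall>i\<in>A. r \<in> Ann R M (K i)}"
proof (intro equalityI subsetI)
  fix r assume "r \<in> Ann R M (submodule_sum M K A)"
  then show "r \<in> {r \<in> carrier R. \<forall>i\<in>A. r \<in> Ann R M (K i)}"
    using Ann_antimono[OF submodule_sum_upper[where K = K, OF _ submoduleE(1)[OF K]]]
    unfolding Ann_def by blast
next
  fix r assume r: "r \<in> {r \<in> carrier R. \<forall>i\<in>A. r \<in> Ann R M (K i)}"
  have "submodule_sum M K A \<subseteq> {x \<in> carrier M. \<forall>a\<in>{r}. a \<odot>\<^bsub>M\<^esub> x \<in> {\<zero>\<^bsub>M\<^esub>}}"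
    using r submoduleE(1)[OF K]
    by (intro submodule_sum_least[OF transporter_submodule[OF zero_submodule]])
       (auto simp: Ann_def)
  then show "r \<in> Ann R M (submodule_sum M K A)" using r unfolding Ann_def by auto
qed

lemma ideal_smult_submodule_sum:
  assumes I: "ideal I R" and K: "\<And>i. i \<in> A \<Longrightarrow> submodule (K i) R M"
  shows "ideal_smult M I (submodule_sum M K A)
    = submodule_sum M (\<lambda>i. ideal_smult M I (K i)) A" (is "?L = ?S")
proof (rule equalityI)
  have IR: "I \<subseteq> carrier R" using ideal.Icarr[OF I] by blast
  have KM: "K i \<subseteq> carrier M" if "i \<in> A" for i using submoduleE(1)[OF K[OF that]] .
  have IK: "submodule (ideal_smult M I (K i)) R M" if "i \<in> A" for i
    using ideal_smult_submodule[OF I K[OF that]] .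
  have S: "submodule ?S R M" by (rule submodule_sum_submodule[OF IK])
  \<comment> \<open>The elements that \<open>I\<close> carries into the right-hand side form a submodule containing every \<open>K i\<close>.\<close>
  have "submodule_sum M K A \<subseteq> {x \<in> carrier M. \<forall>a\<in>I. a \<odot>\<^bsub>M\<^esub> x \<in> ?S}"
    using KM ideal_smult_mem[OF IR KM]
      submodule_sum_upper[where K = "\<lambda>i. ideal_smult M I (K i)", OF _ submoduleE(1)[OF IK]]
    by (intro submodule_sum_least[OF transporter_submodule[OF S IR]]) blast
  then show "?L \<subseteq> ?S" by (intro ideal_smult_least[OF S]) auto
  have L: "submodule ?L R M"
    by (rule ideal_smult_submodule[OF I submodule_sum_submodule[OF K]])
  have carr: "submodule_sum M K A \<subseteq> carrier M"
    using submoduleE(1)[OF submodule_sum_submodule[OF K]] .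
  have "ideal_smult M I (K i) \<subseteq> ?L" if "i \<in> A" for i
    using submodule_sum_upper[where K = K, OF that KM[OF that]]
    by (intro ideal_smult_least[OF L] ideal_smult_mem[OF IR carr]) auto
  then show "?S \<subseteq> ?L" by (rule submodule_sum_least[OF L])
qed

section \<open>Second submodules\<close>

lemma second_submodule_is_submodule: "second_submodule R M K \<Longrightarrow> submodule K R M"
  unfolding second_submodule_def nonzero_submodule_def by blast

lemma ideal_smult_second:
  assumes K: "second_submodule R M K" and I: "ideal I R"
  shows "ideal_smult M I K = (if I \<subseteq> Ann R M K then {\<zero>\<^bsub>M\<^esub>} else K)"
proof -
  have sub: "submodule K R M" using second_submodule_is_submodule[OF K] .
  have IR: "I \<subseteq> carrier R" using ideal.Icarr[OF I] by blast
  show ?thesis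
  proof (cases "I \<subseteq> Ann R M K")
    case True
    then have "ideal_smult M I K \<subseteq> {\<zero>\<^bsub>M\<^esub>}"
      by (intro ideal_smult_least[OF zero_submodule]) (auto simp: Ann_def)
    then show ?thesis using True submodule_zero_mem[OF ideal_smult_submodule[OF I sub]] by auto
  next
    case False
    then obtain a x where ax: "a \<in> I" "x \<in> K" "a \<odot>\<^bsub>M\<^esub> x \<noteq> \<zero>\<^bsub>M\<^esub>"
      using IR unfolding Ann_def by auto
    then have "ideal_smult M I K \<noteq> {\<zero>\<^bsub>M\<^esub>}"
      using ideal_smult_mem[OF IR submoduleE(1)[OF sub]] by blast
    then show ?thesis using False K I unfolding second_submodule_def by auto
  qed
qed

text \<open>
  The colon ideal \<open>I = (L : K)\<close> multiplies \<open>K\<close> into \<open>L\<close>, so \<open>I K = K\<close> is only possible if \<open>K \<subseteq> L\<close>.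
  Otherwise \<open>I\<close> annihilates \<open>K\<close>, and so does its element \<open>r\<close>.
\<close>

lemma second_transport:
  assumes K: "second_submodule R M K" and L: "submodule L R M"
    and r: "r \<in> carrier R" "\<And>x. x \<in> K \<Longrightarrow> r \<odot>\<^bsub>M\<^esub> x \<in> L"
  shows "K \<subseteq> L \<or> r \<in> Ann R M K"
proof -
  let ?C = "{r \<in> carrier R. \<forall>x\<in>K. r \<odot>\<^bsub>M\<^esub> x \<in> L}"
  have KM: "K \<subseteq> carrier M" using submoduleE(1)[OF second_submodule_is_submodule[OF K]] .
  have "ideal_smult M ?C K \<subseteq> L" by (rule ideal_smult_least[OF L]) auto
  then show ?thesis
    using ideal_smult_second[OF K colon_ideal[OF L KM]] r by (auto split: if_splits)
qed

lemma Ann_second_prime: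
  assumes K: "second_submodule R M K"
  shows "primeideal (Ann R M K) R"
proof (rule primeidealI)
  have KM: "K \<subseteq> carrier M" using submoduleE(1)[OF second_submodule_is_submodule[OF K]] .
  show "ideal (Ann R M K) R" using Ann_ideal[OF KM] .
  show "cring R" by (rule R.cring_axioms)
  obtain x where x: "x \<in> K" "x \<noteq> \<zero>\<^bsub>M\<^esub>"
    using K submodule_zero_mem unfolding second_submodule_def nonzero_submodule_def by blast
  then have "\<one>\<^bsub>R\<^esub> \<odot>\<^bsub>M\<^esub> x \<noteq> \<zero>\<^bsub>M\<^esub>" using KM by auto
  then have "\<one>\<^bsub>R\<^esub> \<notin> Ann R M K" using x unfolding Ann_def by blast
  then show "carrier R \<noteq> Ann R M K" by auto
  fix a b assume ab: "a \<in> carrier R" "b \<in> carrier R" "a \<otimes>\<^bsub>R\<^esub> b \<in> Ann R M K"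
  \<comment> \<open>If \<open>ab\<close> kills \<open>K\<close>, then \<open>b\<close> carries \<open>K\<close> into the kernel of multiplication by \<open>a\<close>.\<close>
  let ?L = "{x \<in> carrier M. \<forall>c\<in>{a}. c \<odot>\<^bsub>M\<^esub> x \<in> {\<zero>\<^bsub>M\<^esub>}}"
  have "K \<subseteq> ?L \<or> b \<in> Ann R M K"
  proof (rule second_transport[OF K])
    show "submodule ?L R M" using ab by (intro transporter_submodule zero_submodule) auto
    show "\<And>x. x \<in> K \<Longrightarrow> b \<odot>\<^bsub>M\<^esub> x \<in> ?L"
      using ab KM by (auto simp: Ann_def smult_assoc1[symmetric])
  qed fact
  then show "a \<in> Ann R M K \<or> b \<in> Ann R M K" using ab unfolding Ann_def by auto
qed

text \<open>
  A product of elements, one from each ideal and all outside \<open>p\<close>. The contrapositive says that a prime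
  containing a finite intersection of ideals contains one of them.
\<close>

lemma prime_avoids_common_element:
  assumes p: "primeideal p R" and "finite \<Q>"
    and "\<And>q. q \<in> \<Q> \<Longrightarrow> ideal q R" "\<And>q. q \<in> \<Q> \<Longrightarrow> \<not> q \<subseteq> p"
  shows "\<exists>a\<in>carrier R. a \<notin> p \<and> (\<forall>q\<in>\<Q>. a \<in> q)"
  using assms(2-4)
proof (induction \<Q> rule: finite_induct)
  case empty
  have "\<one>\<^bsub>R\<^esub> \<notin> p"
    using ideal.one_imp_carrier[OF primeideal.axioms(1)[OF p]] primeideal.I_notcarr[OF p] by auto
  then show ?case by auto
next
  case (insert q \<Q>)
  then obtain a where a: "a \<in> carrier R" "a \<notin> p" "\<forall>q\<in>\<Q>. a \<in> q" by blast
  obtain b where b: "b \<in> q" "b \<notin> p" using insert.prems(2)[of q] by blast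
  have q: "ideal q R" using insert.prems(1) by blast
  have bR: "b \<in> carrier R" using ideal.Icarr[OF q b(1)] .
  have "a \<otimes>\<^bsub>R\<^esub> b \<notin> p" using primeideal.I_prime[OF p] a b bR by blast
  moreover have "a \<otimes>\<^bsub>R\<^esub> b \<in> q'" if "q' \<in> insert q \<Q>" for q'
    using that a b bR q insert.prems(1) ideal.I_l_closed ideal.I_r_closed by (metis insert_iff)
  ultimately show ?case using a bR by blast
qed

section \<open>Sums of second submodules\<close>

text \<open>
  Multiplication by \<open>I\<close> only selects summands. This is the source of all statements about
  multiplication modules below.
\<close>

lemma ideal_smult_sum_of_seconds:
  assumes I: "ideal I R" and K: "\<And>i. i \<in> A \<Longrightarrow> second_submodule R M (K i)"
  shows "ideal_smult M I (submodule_sum M K A) = submodule_sum M K {i \<in> A. \<not> I \<subseteq> Ann R M (K i)}"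
proof -
  let ?B = "{i. \<not> I \<subseteq> Ann R M (K i)}"
  have sub: "submodule (K i) R M" if "i \<in> A" for i
    using second_submodule_is_submodule[OF K[OF that]] .
  have "ideal_smult M I (submodule_sum M K A) = submodule_sum M (\<lambda>i. ideal_smult M I (K i)) A"
    by (rule ideal_smult_submodule_sum[OF I sub])
  also have "\<dots> = submodule_sum M (\<lambda>i. if i \<in> ?B then K i else {\<zero>\<^bsub>M\<^esub>}) A"
    unfolding submodule_sum_def using ideal_smult_second[OF K I]
    by (intro Collect_cong ex_cong1 conj_cong refl ball_cong) (auto simp: subset_iff)
  also have "\<dots> = submodule_sum M K (A \<inter> ?B)" by (rule submodule_sum_drop_zero[OF sub])
  finally show ?thesis by (simp add: Int_def)
qed

lemma multiplication_module_subsum: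
  assumes "multiplication_module R M" and K: "\<And>i. i \<in> A \<Longrightarrow> second_submodule R M (K i)"
    and M: "carrier M = submodule_sum M K A" and "submodule N R M"
  shows "\<exists>B\<subseteq>A. N = submodule_sum M K B"
proof -
  obtain I where I: "ideal I R" "N = ideal_smult M I (carrier M)"
    using assms(1,4) unfolding multiplication_module_def by blast
  then have "N = submodule_sum M K {i \<in> A. \<not> I \<subseteq> Ann R M (K i)}"
    using ideal_smult_sum_of_seconds[OF I(1) K] M by simp
  then show ?thesis by (intro exI conjI[rotated]) auto
qed

lemma second_representable_iff_finite_set:
  "second_representable R M N \<longleftrightarrow>
    (\<exists>\<K>. finite \<K> \<and> (\<forall>K\<in>\<K>. second_submodule R M K) \<and> N = submodule_sum M (\<lambda>K. K) \<K>)"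
proof
  assume "second_representable R M N"
  then obtain n K where K: "\<forall>i\<in>{1..n::nat}. second_submodule R M (K i)"
    and N: "N = submodule_sum M K {1..n}"
    unfolding second_representable_def second_representation_def by blast
  have "N = submodule_sum M (\<lambda>K. K) (K ` {1..n})"
    using submodule_sum_image[where K = K and A = "{1..n}"] K second_submodule_is_submodule N by auto
  then show "\<exists>\<K>. finite \<K> \<and> (\<forall>K\<in>\<K>. second_submodule R M K) \<and> N = submodule_sum M (\<lambda>K. K) \<K>"
    using K by (intro exI[of _ "K ` {1..n}"]) auto
next
  assume "\<exists>\<K>. finite \<K> \<and> (\<forall>K\<in>\<K>. second_submodule R M K) \<and> N = submodule_sum M (\<lambda>K. K) \<K>"
  then obtain \<K> where \<K>: "finite \<K>" "\<forall>K\<in>\<K>. second_submodule R M K"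
    and N: "N = submodule_sum M (\<lambda>K. K) \<K>" by blast
  obtain h n where h: "h ` {1..n::nat} = \<K>"
    using ex_bij_betw_nat_finite_1[OF \<K>(1)] unfolding bij_betw_def by blast
  have "N = submodule_sum M h {1..n}"
    using submodule_sum_image[where K = h and A = "{1..n}"] h \<K> second_submodule_is_submodule N by auto
  then show "second_representable R M N"
    unfolding second_representable_def second_representation_def using h \<K> by blast
qed

lemma multiplication_imp_submodule_semisecond:
  assumes "multiplication_module R M" "semisecond R M (carrier M)" "submodule N R M"
  shows "semisecond R M N"
proof -
  obtain \<K> where \<K>: "\<forall>K\<in>\<K>. second_submodule R M K" "carrier M = submodule_sum M (\<lambda>K. K) \<K>"
    using assms(2) unfolding semisecond_def by blast
  obtain \<B> where "\<B> \<subseteq> \<K>" "N = submodule_sum M (\<lambda>K. K) \<B>"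
    using multiplication_module_subsum[OF assms(1) _ \<K>(2) assms(3)] \<K>(1) by auto
  then show ?thesis unfolding semisecond_def using \<K>(1) by blast
qed

lemma multiplication_imp_submodule_second_representable:
  assumes "multiplication_module R M" "second_representable R M (carrier M)" "submodule N R M"
  shows "second_representable R M N"
proof -
  obtain \<K> where \<K>: "finite \<K>" "\<forall>K\<in>\<K>. second_submodule R M K"
    "carrier M = submodule_sum M (\<lambda>K. K) \<K>"
    using assms(2) unfolding second_representable_iff_finite_set by blast
  obtain \<B> where "\<B> \<subseteq> \<K>" "N = submodule_sum M (\<lambda>K. K) \<B>"
    using multiplication_module_subsum[OF assms(1) _ \<K>(3) assms(3)] \<K>(2) by auto
  then show ?thesis unfolding second_representable_iff_finite_set
    using \<K>(1,2) finite_subset by (intro exI[of _ \<B>]) auto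
qed

text \<open>
  A proper submodule that is not small has a proper complement in the sense of sums, and the relation
  \<open>N + L = M\<close> is symmetric, so that \<open>L\<close> is not small either.
\<close>

lemma not_hollow_split:
  assumes "\<not> hollow_module R M"
  obtains N L where "proper_submodule R M N" "\<not> small_submodule R M N"
    "proper_submodule R M L" "\<not> small_submodule R M L" "N <+>\<^bsub>M\<^esub> L = carrier M"
proof -
  obtain N where N: "proper_submodule R M N" "\<not> small_submodule R M N"
    using assms unfolding hollow_module_def by blast
  then obtain L where L: "proper_submodule R M L" "N <+>\<^bsub>M\<^esub> L = carrier M"
    unfolding small_submodule_def proper_submodule_def by blast
  have "N \<subseteq> carrier M" "L \<subseteq> carrier M"
    using N(1) L(1) submoduleE(1) unfolding proper_submodule_def by auto
  then have "L <+>\<^bsub>M\<^esub> N = N <+>\<^bsub>M\<^esub> L"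
    unfolding set_add_def' by (auto simp: M.a_comm subset_iff) (metis M.a_comm)+
  then have "\<not> small_submodule R M L" using N(1) L unfolding small_submodule_def by auto
  with N L show ?thesis using that by blast
qed

lemma set_add_subset_submodule_sum_Un:
  assumes "\<And>i. i \<in> A \<union> B \<Longrightarrow> submodule (K i) R M"
  shows "submodule_sum M K A <+>\<^bsub>M\<^esub> submodule_sum M K B \<subseteq> submodule_sum M K (A \<union> B)"
proof -
  have S: "submodule (submodule_sum M K (A \<union> B)) R M" by (rule submodule_sum_submodule[OF assms])
  have "submodule_sum M K A \<subseteq> submodule_sum M K (A \<union> B)"
    "submodule_sum M K B \<subseteq> submodule_sum M K (A \<union> B)"
    unfolding submodule_sum_def by blast+
  then show ?thesis using submoduleE(5)[OF S] unfolding set_add_def' by blast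
qed

lemma not_hollow_semisecond:
  assumes "\<not> hollow_module R M"
    and ns: "\<And>N. proper_submodule R M N \<Longrightarrow> \<not> small_submodule R M N \<Longrightarrow> semisecond R M N"
  shows "semisecond R M (carrier M)"
proof -
  obtain N L where NL: "proper_submodule R M N" "\<not> small_submodule R M N"
    "proper_submodule R M L" "\<not> small_submodule R M L" "N <+>\<^bsub>M\<^esub> L = carrier M"
    using not_hollow_split[OF assms(1)] .
  obtain \<A> where A: "\<forall>K\<in>\<A>. second_submodule R M K" "N = submodule_sum M (\<lambda>K. K) \<A>"
    using ns[OF NL(1,2)] unfolding semisecond_def by blast
  obtain \<B> where B: "\<forall>K\<in>\<B>. second_submodule R M K" "L = submodule_sum M (\<lambda>K. K) \<B>"
    using ns[OF NL(3,4)] unfolding semisecond_def by blast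
  have sub: "submodule K R M" if "K \<in> \<A> \<union> \<B>" for K
    using that A B second_submodule_is_submodule by blast
  have "carrier M = submodule_sum M (\<lambda>K. K) (\<A> \<union> \<B>)"
    using set_add_subset_submodule_sum_Un[of \<A> \<B> "\<lambda>K. K", OF sub] NL(5) A(2) B(2)
      submoduleE(1)[OF submodule_sum_submodule[of "\<A> \<union> \<B>" "\<lambda>K. K", OF sub]] by auto
  then show ?thesis unfolding semisecond_def using A(1) B(1) by blast
qed

lemma not_hollow_second_representable:
  assumes "\<not> hollow_module R M"
    and ns: "\<And>N. proper_submodule R M N \<Longrightarrow> \<not> small_submodule R M N \<Longrightarrow> second_representable R M N"
  shows "second_representable R M (carrier M)"
proof -
  obtain N L where NL: "proper_submodule R M N" "\<not> small_submodule R M N"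
    "proper_submodule R M L" "\<not> small_submodule R M L" "N <+>\<^bsub>M\<^esub> L = carrier M"
    using not_hollow_split[OF assms(1)] .
  obtain \<A> where A: "finite \<A>" "\<forall>K\<in>\<A>. second_submodule R M K" "N = submodule_sum M (\<lambda>K. K) \<A>"
    using ns[OF NL(1,2)] unfolding second_representable_iff_finite_set by blast
  obtain \<B> where B: "finite \<B>" "\<forall>K\<in>\<B>. second_submodule R M K" "L = submodule_sum M (\<lambda>K. K) \<B>"
    using ns[OF NL(3,4)] unfolding second_representable_iff_finite_set by blast
  have sub: "submodule K R M" if "K \<in> \<A> \<union> \<B>" for K
    using that A B second_submodule_is_submodule by blast
  have "carrier M = submodule_sum M (\<lambda>K. K) (\<A> \<union> \<B>)"
    using set_add_subset_submodule_sum_Un[of \<A> \<B> "\<lambda>K. K", OF sub] NL(5) A(3) B(3)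
      submoduleE(1)[OF submodule_sum_submodule[of "\<A> \<union> \<B>" "\<lambda>K. K", OF sub]] by auto
  then show ?thesis unfolding second_representable_iff_finite_set
    using A(1,2) B(1,2) by (intro exI[of _ "\<A> \<union> \<B>"]) auto
qed

section \<open>Attached primes and minimal second representations\<close>

text \<open>
  The right-hand side does not mention the family, so the set of annihilators is an invariant of \<open>M\<close>.
  For \<open>L\<close> a submodule, \<open>(L : M)\<close> is the intersection of the \<open>Ann (K i)\<close> over those \<open>i\<close> with \<open>K i\<close> not
  contained in \<open>L\<close>; if it is prime it equals one of them. Conversely,
  irredundancy makes \<open>Ann (K j)\<close> the only term when \<open>L\<close> is the sum of the summands other than \<open>K j\<close>.
\<close>

lemma Ann_irredundant_second_sum:
  assumes A: "finite A" and K: "\<And>i. i \<in> A \<Longrightarrow> second_submodule R M (K i)"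
    and M: "carrier M = submodule_sum M K A"
    and irr: "\<And>j. j \<in> A \<Longrightarrow> \<not> K j \<subseteq> submodule_sum M K (A - {j})"
  shows "(\<lambda>i. Ann R M (K i)) ` A
    = {p. primeideal p R \<and> (\<exists>L. submodule L R M \<and> p = {r \<in> carrier R. \<forall>x\<in>carrier M. r \<odot>\<^bsub>M\<^esub> x \<in> L})}"
    (is "_ = ?P")
proof (intro equalityI subsetI)
  have sub: "submodule (K i) R M" if "i \<in> A" for i
    using second_submodule_is_submodule[OF K[OF that]] .
  have KM: "K i \<subseteq> carrier M" if "i \<in> A" for i using submoduleE(1)[OF sub[OF that]] .
  have all: "r \<odot>\<^bsub>M\<^esub> x \<in> L" if L: "submodule L R M" and r: "r \<in> carrier R" and x: "x \<in> carrier M"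
    and Ki: "\<And>i y. i \<in> A \<Longrightarrow> y \<in> K i \<Longrightarrow> r \<odot>\<^bsub>M\<^esub> y \<in> L" for r x L
  proof -
    have "submodule_sum M K A \<subseteq> {x \<in> carrier M. \<forall>a\<in>{r}. a \<odot>\<^bsub>M\<^esub> x \<in> L}"
      using r KM Ki by (intro submodule_sum_least transporter_submodule[OF L]) auto
    then show ?thesis using x M by auto
  qed
  {
    fix p assume "p \<in> (\<lambda>i. Ann R M (K i)) ` A"
    then obtain j where j: "j \<in> A" and p: "p = Ann R M (K j)" by auto
    \<comment> \<open>Modulo the sum of the other summands, \<open>M\<close> is a nonzero quotient of \<open>K j\<close>.\<close>
    let ?L = "submodule_sum M K (A - {j})"
    have L: "submodule ?L R M" using sub by (intro submodule_sum_submodule) auto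
    have "p = {r \<in> carrier R. \<forall>x\<in>carrier M. r \<odot>\<^bsub>M\<^esub> x \<in> ?L}"
    proof (intro equalityI subsetI)
      fix r assume r: "r \<in> p"
      then have rR: "r \<in> carrier R" unfolding p Ann_def by auto
      have "r \<odot>\<^bsub>M\<^esub> y \<in> ?L" if i: "i \<in> A" and y: "y \<in> K i" for i y
      proof (cases "i = j")
        case True
        then show ?thesis using r y submodule_zero_mem[OF L] unfolding p Ann_def by auto
      next
        case False
        then have "K i \<subseteq> ?L" using submodule_sum_upper[where K = K] i KM[OF i] by auto
        then show ?thesis using submoduleE(4)[OF L rR] y by blast
      qed
      then show "r \<in> {r \<in> carrier R. \<forall>x\<in>carrier M. r \<odot>\<^bsub>M\<^esub> x \<in> ?L}" using all[OF L rR] rR by blast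
    next
      fix r assume "r \<in> {r \<in> carrier R. \<forall>x\<in>carrier M. r \<odot>\<^bsub>M\<^esub> x \<in> ?L}"
      then show "r \<in> p"
        using second_transport[OF K[OF j] L, of r] irr[OF j] KM[OF j] unfolding p by blast
    qed
    then show "p \<in> ?P" using L Ann_second_prime[OF K[OF j]] p
      by (intro CollectI conjI exI[of _ ?L]) simp_all
  }
  {
    fix p assume "p \<in> ?P"
    then obtain L where p: "primeideal p R" and L: "submodule L R M"
      and pL: "p = {r \<in> carrier R. \<forall>x\<in>carrier M. r \<odot>\<^bsub>M\<^esub> x \<in> L}" by blast
    let ?B = "{i \<in> A. \<not> K i \<subseteq> L}"
    have le: "p \<subseteq> Ann R M (K i)" if "i \<in> ?B" for i
      using second_transport[OF K L] that KM pL by blast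
    \<comment> \<open>Hence \<open>p\<close> is the intersection of the finitely many primes \<open>Ann (K i)\<close> with \<open>i \<in> ?B\<close>.\<close>
    have "\<exists>i\<in>?B. Ann R M (K i) \<subseteq> p"
    proof (rule ccontr)
      assume none: "\<not> (\<exists>i\<in>?B. Ann R M (K i) \<subseteq> p)"
      let ?Q = "(\<lambda>i. Ann R M (K i)) ` ?B"
      have Q: "finite ?Q" "\<And>q. q \<in> ?Q \<Longrightarrow> ideal q R" "\<And>q. q \<in> ?Q \<Longrightarrow> \<not> q \<subseteq> p"
        using A none Ann_ideal KM by auto
      obtain a where a: "a \<in> carrier R" "a \<notin> p" "\<forall>q\<in>?Q. a \<in> q"
        using prime_avoids_common_element[OF p Q] by auto
      have "a \<odot>\<^bsub>M\<^esub> y \<in> L" if i: "i \<in> A" and y: "y \<in> K i" for i y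
      proof (cases "K i \<subseteq> L")
        case True
        then show ?thesis using submoduleE(4)[OF L a(1)] y by blast
      next
        case False
        then have "a \<in> Ann R M (K i)" using a(3) i by blast
        then show ?thesis using y submodule_zero_mem[OF L] unfolding Ann_def by auto
      qed
      then have "a \<in> p" using all[OF L a(1)] a(1) unfolding pL by blast
      with a(2) show False by blast
    qed
    then show "p \<in> (\<lambda>i. Ann R M (K i)) ` A" using le by blast
  }
qed

lemma att_second_eq:
  assumes "minimal_second_representation R M (carrier M) n K"
  shows "att_second R M = (\<lambda>i. Ann R M (K i)) ` {1..n}"
proof -
  have *: "(\<lambda>i. Ann R M (L i)) ` {1..m} = {p. primeideal p R \<and>
      (\<exists>L. submodule L R M \<and> p = {r \<in> carrier R. \<forall>x\<in>carrier M. r \<odot>\<^bsub>M\<^esub> x \<in> L})}"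
    if "minimal_second_representation R M (carrier M) m L" for m L
    using that unfolding minimal_second_representation_def second_representation_def
    by (intro Ann_irredundant_second_sum) auto
  show ?thesis unfolding att_second_def
  proof (rule the_equality)
    show "\<exists>m L. minimal_second_representation R M (carrier M) m L \<and>
        (\<lambda>i. Ann R M (K i)) ` {1..n} = (\<lambda>i. Ann R M (L i)) ` {1..m}"
      using assms by (intro exI[of _ n] exI[of _ K]) simp
    fix P assume "\<exists>m L. minimal_second_representation R M (carrier M) m L \<and>
        P = (\<lambda>i. Ann R M (L i)) ` {1..m}"
    then obtain m L where L: "minimal_second_representation R M (carrier M) m L"
      "P = (\<lambda>i. Ann R M (L i)) ` {1..m}" by blast
    show "P = (\<lambda>i. Ann R M (K i)) ` {1..n}"
      unfolding L(2) *[OF L(1)] *[OF assms] ..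
  qed
qed

lemma second_submodule_sum_same_Ann:
  assumes "A \<noteq> {}" and K: "\<And>i. i \<in> A \<Longrightarrow> second_submodule R M (K i)"
    and p: "\<And>i. i \<in> A \<Longrightarrow> Ann R M (K i) = p"
  shows "second_submodule R M (submodule_sum M K A)"
proof -
  have sub: "submodule (K i) R M" if "i \<in> A" for i
    using second_submodule_is_submodule[OF K[OF that]] .
  have S: "submodule (submodule_sum M K A) R M" by (rule submodule_sum_submodule[OF sub])
  obtain i where i: "i \<in> A" using assms(1) by blast
  have "K i \<noteq> {\<zero>\<^bsub>M\<^esub>}" "K i \<subseteq> submodule_sum M K A"
    using K[OF i] submodule_sum_upper[where K = K, OF i submoduleE(1)[OF sub[OF i]]]
    unfolding second_submodule_def nonzero_submodule_def by auto
  then have "submodule_sum M K A \<noteq> {\<zero>\<^bsub>M\<^esub>}" using submodule_zero_mem[OF sub[OF i]] by auto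
  moreover have "ideal_smult M I (submodule_sum M K A) = submodule_sum M K A
      \<or> ideal_smult M I (submodule_sum M K A) = {\<zero>\<^bsub>M\<^esub>}" if I: "ideal I R" for I
  proof (cases "I \<subseteq> p")
    case True
    then have none: "{i \<in> A. \<not> I \<subseteq> Ann R M (K i)} = {}" using p by blast
    show ?thesis
      using ideal_smult_sum_of_seconds[where K = K and A = A, OF I K, unfolded none submodule_sum_empty]
      by blast
  next
    case False
    then have all: "{i \<in> A. \<not> I \<subseteq> Ann R M (K i)} = A" using p by blast
    show ?thesis
      using ideal_smult_sum_of_seconds[where K = K and A = A, OF I K, unfolded all] by blast
  qed
  ultimately show ?thesis using S unfolding second_submodule_def nonzero_submodule_def by blast
qed

text \<open>
  A representation with the fewest summands is minimal: otherwise one could drop a redundant summand or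
  merge two summands with the same annihilator.
\<close>

lemma minimal_second_representation_exists:
  assumes "second_representable R M N"
  shows "\<exists>n K. minimal_second_representation R M N n K"
proof -
  define P where "P \<K> \<longleftrightarrow> finite \<K> \<and> (\<forall>K\<in>\<K>. second_submodule R M K)
    \<and> N = submodule_sum M (\<lambda>K. K) \<K>" for \<K>
  obtain \<K>0 where "P \<K>0" using assms unfolding second_representable_iff_finite_set P_def by blast
  then obtain \<K> where P: "P \<K>" and least: "\<And>\<L>. P \<L> \<Longrightarrow> card \<K> \<le> card \<L>"
    using ex_has_least_nat[of P \<K>0 card] by blast
  have fin: "finite \<K>" and second: "\<And>K. K \<in> \<K> \<Longrightarrow> second_submodule R M K"
    and N: "N = submodule_sum M (\<lambda>K. K) \<K>" using P unfolding P_def by auto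
  have sub: "submodule K R M" if "K \<in> \<K>" for K
    using second_submodule_is_submodule[OF second[OF that]] .
  have Nsub: "submodule N R M" unfolding N using sub by (intro submodule_sum_submodule)
  have le: "K \<subseteq> N" if "K \<in> \<K>" for K
    unfolding N using submodule_sum_upper[where K = "\<lambda>K. K", OF that submoduleE(1)[OF sub[OF that]]] .
  have PI: "P \<L>" if "finite \<L>" "\<And>K. K \<in> \<L> \<Longrightarrow> second_submodule R M K" "\<And>K. K \<in> \<L> \<Longrightarrow> K \<subseteq> N"
    "\<And>K. K \<in> \<K> \<Longrightarrow> K \<subseteq> submodule_sum M (\<lambda>K. K) \<L>" for \<L>
  proof -
    have S: "submodule (submodule_sum M (\<lambda>K. K) \<L>) R M"
      using second_submodule_is_submodule[OF that(2)] by (rule submodule_sum_submodule)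
    have "N \<subseteq> submodule_sum M (\<lambda>K. K) \<L>"
      unfolding N using that(4) by (intro submodule_sum_least[OF S])
    moreover have "submodule_sum M (\<lambda>K. K) \<L> \<subseteq> N"
      using that(3) by (intro submodule_sum_least[OF Nsub])
    ultimately show ?thesis using that(1,2) unfolding P_def by blast
  qed
  have upper: "K \<subseteq> submodule_sum M (\<lambda>K. K) \<L>" if "K \<in> \<L>" "submodule K R M" for K \<L>
    using submodule_sum_upper[where K = "\<lambda>K. K", OF that(1) submoduleE(1)[OF that(2)]] .
  have irr: "\<not> K \<subseteq> submodule_sum M (\<lambda>K. K) (\<K> - {K})" if K: "K \<in> \<K>" for K
  proof
    assume red: "K \<subseteq> submodule_sum M (\<lambda>K. K) (\<K> - {K})"
    have "P (\<K> - {K})"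
    proof (rule PI)
      show "L \<subseteq> submodule_sum M (\<lambda>K. K) (\<K> - {K})" if "L \<in> \<K>" for L
        using that red upper[of L "\<K> - {K}"] sub by (cases "L = K") auto
    qed (use fin second le in auto)
    then have "card \<K> \<le> card (\<K> - {K})" by (rule least)
    then show False using card_Diff1_less[OF fin K] by simp
  qed
  have dist: "Ann R M K \<noteq> Ann R M L" if KL: "K \<in> \<K>" "L \<in> \<K>" "K \<noteq> L" for K L
  proof
    assume eq: "Ann R M K = Ann R M L"
    \<comment> \<open>Two summands with the same annihilator merge into one, which shortens the representation.\<close>
    let ?S = "submodule_sum M (\<lambda>K. K) {K, L}"
    let ?\<L> = "insert ?S (\<K> - {K, L})"
    have S: "second_submodule R M ?S"
      using KL second eq by (intro second_submodule_sum_same_Ann[where p = "Ann R M L"]) auto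
    have SN: "?S \<subseteq> N" using KL le by (intro submodule_sum_least[OF Nsub]) auto
    have "P ?\<L>"
    proof (rule PI)
      show "J \<subseteq> submodule_sum M (\<lambda>K. K) ?\<L>" if J: "J \<in> \<K>" for J
      proof (cases "J \<in> {K, L}")
        case True
        then have "J \<subseteq> ?S" using upper[OF _ sub[OF J]] by blast
        also have "\<dots> \<subseteq> submodule_sum M (\<lambda>K. K) ?\<L>"
          using upper[OF _ second_submodule_is_submodule[OF S]] by blast
        finally show ?thesis .
      next
        case False
        then show ?thesis using J by (intro upper sub) auto
      qed
    qed (use fin second le S SN in auto)
    then have "card \<K> \<le> card ?\<L>" by (rule least)
    also have "\<dots> \<le> Suc (card (\<K> - {K, L}))" using fin by (simp add: card_insert_if)
    also have "\<dots> = Suc (card \<K> - 2)" using KL fin by (simp add: card_Diff_subset)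
    finally have "card \<K> \<le> Suc (card \<K> - 2)" .
    moreover have "card {K, L} \<le> card \<K>" using KL fin by (intro card_mono) auto
    ultimately show False using KL(3) by simp
  qed
  obtain h n where h: "bij_betw h {1..n::nat} \<K>"
    using ex_bij_betw_nat_finite_1[OF fin] by blast
  have hK: "h i \<in> \<K>" if "i \<in> {1..n}" for i using h that unfolding bij_betw_def by auto
  have hinj: "h i \<noteq> h j" if "i \<in> {1..n}" "j \<in> {1..n}" "i \<noteq> j" for i j
    using h that unfolding bij_betw_def inj_on_def by blast
  have img: "submodule_sum M h B = submodule_sum M (\<lambda>K. K) (h ` B)" if "B \<subseteq> {1..n}" for B
    using submodule_sum_image[of B h] sub hK that by (metis subsetD)
  have rep: "N = submodule_sum M h {1..n}"
    using img[of "{1..n}"] N h unfolding bij_betw_def by simp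
  have hirr: "\<not> h j \<subseteq> submodule_sum M h ({1..n} - {j})" if j: "j \<in> {1..n}" for j
  proof -
    have "h ` ({1..n} - {j}) = h ` {1..n} - h ` {j}"
      using h j unfolding bij_betw_def by (intro inj_on_image_set_diff[of h "{1..n}"]) auto
    then have "h ` ({1..n} - {j}) = \<K> - {h j}" using h unfolding bij_betw_def by simp
    then show ?thesis using img[of "{1..n} - {j}"] irr[OF hK[OF j]] by simp
  qed
  have "minimal_second_representation R M N n h"
    unfolding minimal_second_representation_def second_representation_def
    using second[OF hK] rep dist[OF hK hK hinj] hirr by (intro conjI ballI impI) simp_all
  then show ?thesis by blast
qed

section \<open>Multiplication modules with a minimal second representation\<close>

lemma multiplication_Ann_incomparable:
  assumes mult: "multiplication_module R M"
    and rep: "minimal_second_representation R M (carrier M) n K"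
    and ij: "i \<in> {1..n}" "j \<in> {1..n}" "i \<noteq> j"
  shows "\<not> Ann R M (K i) \<subseteq> Ann R M (K j)"
proof
  assume le: "Ann R M (K i) \<subseteq> Ann R M (K j)"
  have K: "\<And>i. i \<in> {1..n} \<Longrightarrow> second_submodule R M (K i)" and M: "carrier M = submodule_sum M K {1..n}"
    and irr: "\<And>j. j \<in> {1..n} \<Longrightarrow> \<not> K j \<subseteq> submodule_sum M K ({1..n} - {j})"
    using rep unfolding minimal_second_representation_def second_representation_def by auto
  have sub: "submodule (K i) R M" if "i \<in> {1..n}" for i
    using second_submodule_is_submodule[OF K[OF that]] .
  obtain I where I: "ideal I R" and Kj: "K j = ideal_smult M I (carrier M)"
    using mult sub[OF ij(2)] unfolding multiplication_module_def by blast
  let ?B = "{k \<in> {1..n}. \<not> I \<subseteq> Ann R M (K k)}"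
  have KjB: "K j = submodule_sum M K ?B"
    using ideal_smult_sum_of_seconds[where K = K and A = "{1..n}", OF I K] Kj M by simp
  \<comment> \<open>\<open>I\<close> does not kill \<open>K j\<close>, since otherwise \<open>K j\<close> would be a sum of other summands;
     hence it does not kill \<open>K i\<close> either, and \<open>K i \<subseteq> K j\<close>.\<close>
  have "j \<in> ?B"
  proof (rule ccontr)
    assume "j \<notin> ?B"
    then have "?B \<subseteq> {1..n} - {j}" by blast
    from submodule_sum_mono[OF this, of K] show False using irr[OF ij(2)] KjB by simp
  qed
  then have "i \<in> ?B" using le ij by blast
  then have "K i \<subseteq> K j"
    using submodule_sum_upper[where K = K and i = i and A = ?B] submoduleE(1)[OF sub[OF ij(1)]] KjB
    by simp
  also have "\<dots> \<subseteq> submodule_sum M K ({1..n} - {i})"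
    using submodule_sum_upper[where K = K and i = j and A = "{1..n} - {i}"]
      submoduleE(1)[OF sub[OF ij(2)]] ij by simp
  finally show False using irr[OF ij(1)] by simp
qed

text \<open>
  In a multiplication module \<open>L\<close> is a subsum, and its annihilator is the intersection of the annihilators of the summands
  involved. Being prime it contains one of these, which lies in all others, so that by incomparability
  there is only one summand.
\<close>

lemma multiplication_second_is_summand:
  assumes mult: "multiplication_module R M"
    and rep: "minimal_second_representation R M (carrier M) n K"
    and L: "second_submodule R M L"
  shows "\<exists>k\<in>{1..n}. L = K k"
proof -
  have K: "\<And>i. i \<in> {1..n} \<Longrightarrow> second_submodule R M (K i)" and M: "carrier M = submodule_sum M K {1..n}"
    using rep unfolding minimal_second_representation_def second_representation_def by auto
  have sub: "submodule (K i) R M" if "i \<in> {1..n}" for i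
    using second_submodule_is_submodule[OF K[OF that]] .
  obtain B where B: "B \<subseteq> {1..n}" and LB: "L = submodule_sum M K B"
    using multiplication_module_subsum[where K = K and A = "{1..n}", OF mult K M second_submodule_is_submodule[OF L]] by auto
  have finB: "finite B" using B finite_subset by blast
  have AnnL: "Ann R M L = {r \<in> carrier R. \<forall>i\<in>B. r \<in> Ann R M (K i)}"
    unfolding LB using sub B by (intro Ann_submodule_sum) auto
  have "\<exists>k\<in>B. Ann R M (K k) \<subseteq> Ann R M L"
  proof (rule ccontr)
    assume none: "\<not> (\<exists>k\<in>B. Ann R M (K k) \<subseteq> Ann R M L)"
    let ?Q = "(\<lambda>i. Ann R M (K i)) ` B"
    have Q: "finite ?Q" "\<And>q. q \<in> ?Q \<Longrightarrow> ideal q R" "\<And>q. q \<in> ?Q \<Longrightarrow> \<not> q \<subseteq> Ann R M L"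
      using finB none Ann_ideal submoduleE(1)[OF sub] B by auto
    obtain a where "a \<in> carrier R" "a \<notin> Ann R M L" "\<forall>q\<in>?Q. a \<in> q"
      using prime_avoids_common_element[OF Ann_second_prime[OF L] Q] by auto
    then show False unfolding AnnL by auto
  qed
  then obtain k where k: "k \<in> B" "Ann R M (K k) \<subseteq> Ann R M L" by blast
  have "i = k" if "i \<in> B" for i
  proof (rule ccontr)
    assume "i \<noteq> k"
    moreover have "Ann R M L \<subseteq> Ann R M (K i)" unfolding AnnL using that by blast
    ultimately show False
      using multiplication_Ann_incomparable[OF mult rep, of k i] k that B by blast
  qed
  then have "B = {k}" using k by blast
  then show ?thesis using submodule_sum_singleton[of K k] sub k B LB by blast
qed

text \<open>
  A prime that contains a finite intersection of ideals contains one of them. Hence the annihilator of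
  the summands outside \<open>B\<close> kills no summand in \<open>B\<close>, and multiplying \<open>M\<close> by it gives the subsum over \<open>B\<close>.
\<close>

lemma incomparable_subsums_imp_multiplication:
  assumes A: "finite A" and K: "\<And>i. i \<in> A \<Longrightarrow> second_submodule R M (K i)"
    and M: "carrier M = submodule_sum M K A"
    and inc: "\<And>i j. i \<in> A \<Longrightarrow> j \<in> A \<Longrightarrow> i \<noteq> j \<Longrightarrow> \<not> Ann R M (K i) \<subseteq> Ann R M (K j)"
    and subsum: "\<And>N. nonzero_submodule R M N \<Longrightarrow> \<exists>B\<subseteq>A. N = submodule_sum M K B"
  shows "multiplication_module R M"
  unfolding multiplication_module_def
proof (intro allI impI)
  fix N assume N: "submodule N R M"
  obtain B where B: "B \<subseteq> A" and NB: "N = submodule_sum M K B"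
  proof (cases "N = {\<zero>\<^bsub>M\<^esub>}")
    case True
    then show ?thesis using that[of "{}"] by (simp add: submodule_sum_empty)
  next
    case False
    then show ?thesis using subsum[of N] N that unfolding nonzero_submodule_def by blast
  qed
  have sub: "submodule (K i) R M" if "i \<in> A" for i
    using second_submodule_is_submodule[OF K[OF that]] .
  have KM: "K i \<subseteq> carrier M" if "i \<in> A" for i using submoduleE(1)[OF sub[OF that]] .
  \<comment> \<open>The ideal that kills exactly the summands outside \<open>B\<close>.\<close>
  define I where "I = Ann R M (submodule_sum M K (A - B))"
  have S: "submodule (submodule_sum M K (A - B)) R M" using sub by (intro submodule_sum_submodule) auto
  have I: "ideal I R" unfolding I_def using Ann_ideal[OF submoduleE(1)[OF S]] .
  have I_eq: "I = {r \<in> carrier R. \<forall>i\<in>A - B. r \<in> Ann R M (K i)}"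
    unfolding I_def using sub by (intro Ann_submodule_sum) auto
  have "\<not> I \<subseteq> Ann R M (K i)" if i: "i \<in> B" for i
  proof -
    let ?Q = "(\<lambda>i. Ann R M (K i)) ` (A - B)"
    have iA: "i \<in> A" using i B by blast
    have Q: "finite ?Q" "\<And>q. q \<in> ?Q \<Longrightarrow> ideal q R" "\<And>q. q \<in> ?Q \<Longrightarrow> \<not> q \<subseteq> Ann R M (K i)"
      using A Ann_ideal KM inc[OF _ iA] i by auto
    obtain a where "a \<in> carrier R" "a \<notin> Ann R M (K i)" "\<forall>q\<in>?Q. a \<in> q"
      using prime_avoids_common_element[OF Ann_second_prime[OF K[OF iA]] Q] by auto
    then show ?thesis unfolding I_eq by auto
  qed
  moreover have "I \<subseteq> Ann R M (K i)" if "i \<in> A - B" for i unfolding I_eq using that by blast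
  ultimately have "{i \<in> A. \<not> I \<subseteq> Ann R M (K i)} = B" using B by blast
  then have "ideal_smult M I (carrier M) = N"
    unfolding M NB using ideal_smult_sum_of_seconds[where K = K and A = A, OF I K] by simp
  then show "\<exists>I. ideal I R \<and> N = ideal_smult M I (carrier M)" using I by blast
qed

lemma incomparable_iff_minimal_elements:
  "X = minimal_elements X \<longleftrightarrow> (\<forall>p\<in>X. \<forall>q\<in>X. p \<noteq> q \<longrightarrow> \<not> p \<subseteq> q)"
  unfolding minimal_elements_def by blast

lemma multiplication_iff_minimal_representation:
  assumes rep: "minimal_second_representation R M (carrier M) n K"
  shows "multiplication_module R M \<longleftrightarrow>
           Att_second R M = att_second R M \<and>
           att_second R M = minimal_elements (att_second R M) \<and>
           (\<forall>N. nonzero_submodule R M N \<longrightarrow> (\<exists>A. A \<subseteq> {1..n} \<and> N = submodule_sum M K A))"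
    (is "_ \<longleftrightarrow> ?b")
proof
  have K: "\<And>i. i \<in> {1..n} \<Longrightarrow> second_submodule R M (K i)" and M: "carrier M = submodule_sum M K {1..n}"
    and dist: "\<And>i j. i \<in> {1..n} \<Longrightarrow> j \<in> {1..n} \<Longrightarrow> i \<noteq> j \<Longrightarrow> Ann R M (K i) \<noteq> Ann R M (K j)"
    using rep unfolding minimal_second_representation_def second_representation_def by auto
  note att = att_second_eq[OF rep]
  {
    assume mult: "multiplication_module R M"
    have "Att_second R M = att_second R M"
      unfolding att Att_second_def using K multiplication_second_is_summand[OF mult rep] by blast
    moreover have "att_second R M = minimal_elements (att_second R M)"
      unfolding incomparable_iff_minimal_elements
    proof (intro ballI impI)
      fix p q assume "p \<in> att_second R M" "q \<in> att_second R M" "p \<noteq> q"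
      then obtain i j where ij: "i \<in> {1..n}" "j \<in> {1..n}" "i \<noteq> j"
        "p = Ann R M (K i)" "q = Ann R M (K j)" unfolding att by blast
      show "\<not> p \<subseteq> q"
        unfolding ij(4,5) by (rule multiplication_Ann_incomparable[OF mult rep ij(1-3)])
    qed
    moreover have "\<exists>A\<subseteq>{1..n}. N = submodule_sum M K A" if "nonzero_submodule R M N" for N
      using multiplication_module_subsum[where K = K and A = "{1..n}", OF mult K M] that unfolding nonzero_submodule_def by simp
    ultimately show ?b by blast
  }
  {
    assume b: ?b
    have inc: "\<not> Ann R M (K i) \<subseteq> Ann R M (K j)" if "i \<in> {1..n}" "j \<in> {1..n}" "i \<noteq> j" for i j
    proof -
      have "\<forall>p\<in>att_second R M. \<forall>q\<in>att_second R M. p \<noteq> q \<longrightarrow> \<not> p \<subseteq> q"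
        using b incomparable_iff_minimal_elements by metis
      moreover have "Ann R M (K i) \<in> att_second R M" "Ann R M (K j) \<in> att_second R M"
        unfolding att using that by auto
      ultimately show ?thesis using dist[OF that] by simp
    qed
    show "multiplication_module R M"
      by (rule incomparable_subsums_imp_multiplication[OF _ K M inc]) (use b in auto)
  }
qed

section \<open>Simple submodules and semisimple modules\<close>

lemma diff_zero_imp_eq:
  "\<lbrakk>x \<in> carrier M; y \<in> carrier M; x \<ominus>\<^bsub>M\<^esub> y = \<zero>\<^bsub>M\<^esub>\<rbrakk> \<Longrightarrow> x = y"
  by (metis M.minus_eq M.minus_equality M.minus_minus M.a_inv_closed)

lemma submodule_inter:
  assumes "submodule N R M" "submodule L R M"
  shows "submodule (N \<inter> L) R M"
  using submoduleE[OF assms(1)] submoduleE[OF assms(2)]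
    submodule_zero_mem[OF assms(1)] submodule_zero_mem[OF assms(2)]
  by (intro submoduleI) auto

lemma cyclic_submodule:
  assumes x: "x \<in> carrier M"
  shows "submodule ((\<lambda>r. r \<odot>\<^bsub>M\<^esub> x) ` carrier R) R M"
proof (rule submoduleI)
  show "\<zero>\<^bsub>M\<^esub> \<in> (\<lambda>r. r \<odot>\<^bsub>M\<^esub> x) ` carrier R"
    using x smult_l_null by (metis R.zero_closed image_eqI)
next
  fix y assume "y \<in> (\<lambda>r. r \<odot>\<^bsub>M\<^esub> x) ` carrier R"
  then show "\<ominus>\<^bsub>M\<^esub> y \<in> (\<lambda>r. r \<odot>\<^bsub>M\<^esub> x) ` carrier R"
    using x by (auto simp: smult_l_minus[symmetric])
next
  fix y z assume "y \<in> (\<lambda>r. r \<odot>\<^bsub>M\<^esub> x) ` carrier R" "z \<in> (\<lambda>r. r \<odot>\<^bsub>M\<^esub> x) ` carrier R"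
  then show "y \<oplus>\<^bsub>M\<^esub> z \<in> (\<lambda>r. r \<odot>\<^bsub>M\<^esub> x) ` carrier R"
    using x by (auto simp: smult_l_distr[symmetric])
next
  fix a y assume "a \<in> carrier R" "y \<in> (\<lambda>r. r \<odot>\<^bsub>M\<^esub> x) ` carrier R"
  then show "a \<odot>\<^bsub>M\<^esub> y \<in> (\<lambda>r. r \<odot>\<^bsub>M\<^esub> x) ` carrier R"
    using x by (auto simp: smult_assoc1[symmetric])
qed (use x in auto)

lemma mem_cyclic: "x \<in> carrier M \<Longrightarrow> x \<in> (\<lambda>r. r \<odot>\<^bsub>M\<^esub> x) ` carrier R"
  using smult_one[of x] by (metis R.one_closed image_eqI)

lemma simple_submodule_is_submodule: "simple_submodule R M S \<Longrightarrow> submodule S R M"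
  unfolding simple_submodule_def nonzero_submodule_def by blast

text \<open>
  The intersection \<open>S \<inter> N\<close> contains \<open>x\<close>, hence is a nonzero submodule of \<open>S\<close>.
\<close>

lemma simple_submodule_le:
  assumes S: "simple_submodule R M S" and N: "submodule N R M"
    and x: "x \<in> S" "x \<in> N" "x \<noteq> \<zero>\<^bsub>M\<^esub>"
  shows "S \<subseteq> N"
proof -
  have "nonzero_submodule R M (S \<inter> N)"
    using submodule_inter[OF simple_submodule_is_submodule[OF S] N] x
    unfolding nonzero_submodule_def by blast
  then have "S \<inter> N = S" using S unfolding simple_submodule_def by blast
  then show ?thesis by blast
qed

lemma simple_submodule_generated:
  assumes S: "simple_submodule R M S" and x: "x \<in> S" "x \<noteq> \<zero>\<^bsub>M\<^esub>" and y: "y \<in> S"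
  obtains r where "r \<in> carrier R" "y = r \<odot>\<^bsub>M\<^esub> x"
proof -
  have xM: "x \<in> carrier M" using x submoduleE(1)[OF simple_submodule_is_submodule[OF S]] by blast
  have "S \<subseteq> (\<lambda>r. r \<odot>\<^bsub>M\<^esub> x) ` carrier R"
    by (rule simple_submodule_le[OF S cyclic_submodule[OF xM] x(1) mem_cyclic[OF xM] x(2)])
  then show ?thesis using y that by auto
qed

lemma simple_submodule_Ann_iff:
  assumes S: "simple_submodule R M S" and x: "x \<in> S" "x \<noteq> \<zero>\<^bsub>M\<^esub>" and a: "a \<in> carrier R"
  shows "a \<in> Ann R M S \<longleftrightarrow> a \<odot>\<^bsub>M\<^esub> x = \<zero>\<^bsub>M\<^esub>"
proof
  show "a \<odot>\<^bsub>M\<^esub> x = \<zero>\<^bsub>M\<^esub>" if "a \<in> Ann R M S" using that x unfolding Ann_def by auto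
  assume ax: "a \<odot>\<^bsub>M\<^esub> x = \<zero>\<^bsub>M\<^esub>"
  have xM: "x \<in> carrier M" using x submoduleE(1)[OF simple_submodule_is_submodule[OF S]] by blast
  have "a \<odot>\<^bsub>M\<^esub> y = \<zero>\<^bsub>M\<^esub>" if y: "y \<in> S" for y
  proof -
    obtain r where r: "r \<in> carrier R" "y = r \<odot>\<^bsub>M\<^esub> x"
      using simple_submodule_generated[OF S x y] .
    have "a \<odot>\<^bsub>M\<^esub> y = r \<odot>\<^bsub>M\<^esub> (a \<odot>\<^bsub>M\<^esub> x)"
      using r a xM smult_assoc1 R.m_comm by metis
    then show ?thesis using ax r by simp
  qed
  then show "a \<in> Ann R M S" using a unfolding Ann_def by blast
qed

lemma simple_imp_second:
  assumes S: "simple_submodule R M S"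
  shows "second_submodule R M S"
proof -
  have sub: "submodule S R M" using simple_submodule_is_submodule[OF S] .
  have "ideal_smult M I S = S \<or> ideal_smult M I S = {\<zero>\<^bsub>M\<^esub>}" if I: "ideal I R" for I
    using S ideal_smult_submodule[OF I sub] ideal_smult_subset[OF I sub]
    unfolding simple_submodule_def nonzero_submodule_def by blast
  then show ?thesis using S unfolding second_submodule_def simple_submodule_def by blast
qed

lemma submodule_sum_split:
  assumes K: "\<And>i. i \<in> A \<Longrightarrow> submodule (K i) R M" and j: "j \<in> A" and y: "y \<in> submodule_sum M K A"
  obtains u v where "u \<in> K j" "v \<in> submodule_sum M K (A - {j})" "y = u \<oplus>\<^bsub>M\<^esub> v"
proof -
  obtain F f where F: "finite F" "F \<subseteq> A" "\<forall>i\<in>F. f i \<in> K i" and yF: "y = (\<Oplus>\<^bsub>M\<^esub>i\<in>F. f i)"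
    using y unfolding submodule_sum_def by blast
  let ?v = "\<Oplus>\<^bsub>M\<^esub>i\<in>F - {j}. f i"
  have v: "?v \<in> submodule_sum M K (A - {j})"
    unfolding submodule_sum_def using F by (intro CollectI exI[of _ "F - {j}"] exI[of _ f]) auto
  have fM: "f i \<in> carrier M" if "i \<in> F" for i using that F submoduleE(1)[OF K] by blast
  have vM: "?v \<in> carrier M" using fM by (intro M.finsum_closed) auto
  show ?thesis
  proof (cases "j \<in> F")
    case True
    then have "y = f j \<oplus>\<^bsub>M\<^esub> ?v"
      unfolding yF using M.finsum_insert[of "F - {j}" j f] F(1) fM by (auto simp: insert_absorb)
    then show ?thesis using that F(3) True v by blast
  next
    case False
    then have "y = \<zero>\<^bsub>M\<^esub> \<oplus>\<^bsub>M\<^esub> ?v" unfolding yF using vM by simp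
    then show ?thesis using that submodule_zero_mem[OF K[OF j]] v by blast
  qed
qed

text \<open>
  Choose the least number of simple summands whose sum meets \<open>K\<close> nontrivially. Write
  this sum as \<open>S + V\<close> with \<open>S\<close> one of the summands. Since \<open>K \<inter> V = 0\<close>, the intersection of \<open>K\<close> with
  \<open>S + V\<close> embeds into the quotient \<open>(S + V)/V\<close> of \<open>S\<close>, hence is itself simple.
\<close>

lemma semisimple_nonzero_contains_simple:
  assumes ss: "semisimple_module R M" and K: "nonzero_submodule R M K"
  obtains S where "simple_submodule R M S" "S \<subseteq> K"
proof -
  obtain \<S> where simple: "\<And>S. S \<in> \<S> \<Longrightarrow> simple_submodule R M S"
    and M: "carrier M = submodule_sum M (\<lambda>S. S) \<S>"
    using ss unfolding semisimple_module_def by blast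
  have Ksub: "submodule K R M" using K unfolding nonzero_submodule_def by blast
  define P where "P F \<longleftrightarrow> finite F \<and> F \<subseteq> \<S> \<and> \<not> K \<inter> submodule_sum M (\<lambda>S. S) F \<subseteq> {\<zero>\<^bsub>M\<^esub>}" for F
  obtain x where x: "x \<in> K" "x \<noteq> \<zero>\<^bsub>M\<^esub>"
    using K submodule_zero_mem unfolding nonzero_submodule_def by blast
  then have "x \<in> submodule_sum M (\<lambda>S. S) \<S>" using M submoduleE(1)[OF Ksub] by blast
  then obtain F f where F: "finite F" "F \<subseteq> \<S>" "\<forall>S\<in>F. f S \<in> S" "x = (\<Oplus>\<^bsub>M\<^esub>S\<in>F. f S)"
    unfolding submodule_sum_def by blast
  have "x \<in> submodule_sum M (\<lambda>S. S) F"
    unfolding submodule_sum_def using F by (intro CollectI exI[of _ F] exI[of _ f]) auto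
  then have "P F" using F(1,2) x unfolding P_def by blast
  then obtain G where G: "P G" and least: "\<And>H. P H \<Longrightarrow> card G \<le> card H"
    using ex_has_least_nat[of P F card] by blast
  let ?N = "K \<inter> submodule_sum M (\<lambda>S. S) G"
  have finG: "finite G" and GS: "G \<subseteq> \<S>" and Nne: "\<not> ?N \<subseteq> {\<zero>\<^bsub>M\<^esub>}" using G unfolding P_def by auto
  have sub: "submodule S R M" if "S \<in> G" for S using simple_submodule_is_submodule[OF simple] GS that by blast
  have "G \<noteq> {}" using Nne by (auto simp: submodule_sum_empty)
  then obtain S where S: "S \<in> G" by blast
  let ?V = "submodule_sum M (\<lambda>S. S) (G - {S})"
  have V: "submodule ?V R M" using sub by (intro submodule_sum_submodule) auto
  have VM: "?V \<subseteq> carrier M" using submoduleE(1)[OF V] .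
  have SM: "S \<subseteq> carrier M" using submoduleE(1)[OF sub[OF S]] .
  \<comment> \<open>By minimality of \<open>G\<close>, the projection of \<open>?N\<close> to the summand \<open>S\<close> has no kernel.\<close>
  have KV: "K \<inter> ?V \<subseteq> {\<zero>\<^bsub>M\<^esub>}"
  proof (rule ccontr)
    assume "\<not> K \<inter> ?V \<subseteq> {\<zero>\<^bsub>M\<^esub>}"
    then have "P (G - {S})" unfolding P_def using finG GS by auto
    then show False using least card_Diff1_less[OF finG S] by fastforce
  qed
  have N: "nonzero_submodule R M ?N"
    using submodule_inter[OF Ksub submodule_sum_submodule[where K = "\<lambda>S. S", OF sub]] Nne
    unfolding nonzero_submodule_def by auto
  have "simple_submodule R M ?N"
    unfolding simple_submodule_def
  proof (intro conjI allI impI N)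
    fix N' assume N': "nonzero_submodule R M N' \<and> N' \<subseteq> ?N"
    then have N'sub: "submodule N' R M" unfolding nonzero_submodule_def by blast
    obtain z where z: "z \<in> N'" "z \<noteq> \<zero>\<^bsub>M\<^esub>"
      using N' submodule_zero_mem[OF N'sub] unfolding nonzero_submodule_def by blast
    obtain s t where st: "s \<in> S" "t \<in> ?V" "z = s \<oplus>\<^bsub>M\<^esub> t"
      using submodule_sum_split[where K = "\<lambda>S. S", OF sub S] z N' by blast
    have "s \<noteq> \<zero>\<^bsub>M\<^esub>"
    proof
      assume "s = \<zero>\<^bsub>M\<^esub>"
      then have "z \<in> K \<inter> ?V" using st z N' VM by auto
      then show False using KV z(2) by blast
    qed
    have "y \<in> N'" if y: "y \<in> ?N" for y
    proof -
      obtain u v where uv: "u \<in> S" "v \<in> ?V" "y = u \<oplus>\<^bsub>M\<^esub> v"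
        using submodule_sum_split[where K = "\<lambda>S. S", OF sub S] y by blast
      obtain r where r: "r \<in> carrier R" "u = r \<odot>\<^bsub>M\<^esub> s"
        using simple_submodule_generated[OF simple st(1) \<open>s \<noteq> \<zero>\<^bsub>M\<^esub>\<close> uv(1)] S GS by blast
      have c: "s \<in> carrier M" "t \<in> carrier M" "u \<in> carrier M" "v \<in> carrier M" "z \<in> carrier M"
        "y \<in> carrier M" "r \<odot>\<^bsub>M\<^esub> t \<in> carrier M"
        using st uv SM VM r by auto
      \<comment> \<open>Subtracting \<open>r z\<close> removes the \<open>S\<close>-component of \<open>y\<close> and leaves an element of \<open>K \<inter> ?V\<close>.\<close>
      have "y \<ominus>\<^bsub>M\<^esub> r \<odot>\<^bsub>M\<^esub> z = v \<ominus>\<^bsub>M\<^esub> r \<odot>\<^bsub>M\<^esub> t"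
        unfolding uv(3) st(3) r(2) using c r
        by (simp add: smult_r_distr M.minus_eq M.minus_add M.a_ac M.r_neg1 M.r_neg2)
      moreover have "v \<ominus>\<^bsub>M\<^esub> r \<odot>\<^bsub>M\<^esub> t \<in> ?V"
        unfolding M.minus_eq using submoduleE(3,4,5)[OF V] uv(2) st(2) r(1) by blast
      moreover have "y \<ominus>\<^bsub>M\<^esub> r \<odot>\<^bsub>M\<^esub> z \<in> K"
        unfolding M.minus_eq using submoduleE(3,4,5)[OF Ksub] y z(1) N' r(1) by blast
      ultimately have "y \<ominus>\<^bsub>M\<^esub> r \<odot>\<^bsub>M\<^esub> z = \<zero>\<^bsub>M\<^esub>" using KV by auto
      then have "y = r \<odot>\<^bsub>M\<^esub> z" using diff_zero_imp_eq[OF c(6)] c r by simp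
      then show ?thesis using submoduleE(4)[OF N'sub r(1) z(1)] by simp
    qed
    then show "N' = ?N" using N' by blast
  qed
  then show ?thesis using that by blast
qed

text \<open>
  With pairwise incomparable annihilators there are scalars that isolate the components of an element of \<open>N\<close>, so every
  summand with a nonzero component lies in \<open>N\<close>.
\<close>

lemma simple_incomparable_submodule_eq_subsum:
  assumes A: "finite A" and K: "\<And>i. i \<in> A \<Longrightarrow> simple_submodule R M (K i)"
    and M: "carrier M = submodule_sum M K A"
    and inc: "\<And>i j. i \<in> A \<Longrightarrow> j \<in> A \<Longrightarrow> i \<noteq> j \<Longrightarrow> \<not> Ann R M (K i) \<subseteq> Ann R M (K j)"
    and N: "submodule N R M"
  shows "N = submodule_sum M K {j \<in> A. K j \<subseteq> N}" (is "N = submodule_sum M K ?B")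
proof (rule equalityI)
  have sub: "submodule (K i) R M" if "i \<in> A" for i
    using simple_submodule_is_submodule[OF K[OF that]] .
  have KM: "K i \<subseteq> carrier M" if "i \<in> A" for i using submoduleE(1)[OF sub[OF that]] .
  have S: "submodule (submodule_sum M K ?B) R M" using sub by (intro submodule_sum_submodule) auto
  show "submodule_sum M K ?B \<subseteq> N" by (rule submodule_sum_least[OF N]) auto
  show "N \<subseteq> submodule_sum M K ?B"
  proof
    fix x assume x: "x \<in> N"
    then have "x \<in> submodule_sum M K A" using submoduleE(1)[OF N] M by blast
    then obtain F f where F: "finite F" "F \<subseteq> A" "\<forall>i\<in>F. f i \<in> K i" and xF: "x = (\<Oplus>\<^bsub>M\<^esub>i\<in>F. f i)"
      unfolding submodule_sum_def by blast
    have fM: "f i \<in> carrier M" if "i \<in> F" for i using that F KM by blast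
    have "f j \<in> submodule_sum M K ?B" if j: "j \<in> F" for j
    proof (cases "f j = \<zero>\<^bsub>M\<^esub>")
      case True
      then show ?thesis using submodule_zero_mem[OF S] by simp
    next
      case False
      have jA: "j \<in> A" and fj: "f j \<in> K j" using j F by auto
      \<comment> \<open>An element that kills all summands except \<open>K j\<close> isolates the component \<open>f j\<close>.\<close>
      let ?Q = "(\<lambda>i. Ann R M (K i)) ` (A - {j})"
      have Q: "finite ?Q" "\<And>q. q \<in> ?Q \<Longrightarrow> ideal q R" "\<And>q. q \<in> ?Q \<Longrightarrow> \<not> q \<subseteq> Ann R M (K j)"
        using A Ann_ideal KM inc[OF _ jA] by auto
      obtain a where a: "a \<in> carrier R" "a \<notin> Ann R M (K j)" "\<forall>q\<in>?Q. a \<in> q"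
        using prime_avoids_common_element[OF Ann_second_prime[OF simple_imp_second[OF K[OF jA]]] Q]
        by auto
      have kill: "a \<odot>\<^bsub>M\<^esub> f i = \<zero>\<^bsub>M\<^esub>" if "i \<in> F" "i \<noteq> j" for i
        using that a(3) F unfolding Ann_def by auto
      have "a \<odot>\<^bsub>M\<^esub> x = (\<Oplus>\<^bsub>M\<^esub>i\<in>F. a \<odot>\<^bsub>M\<^esub> f i)"
        unfolding xF using F(1) a(1) fM by (intro finsum_smult_ldistr) auto
      also have "\<dots> = (\<Oplus>\<^bsub>M\<^esub>i\<in>F. if j = i then a \<odot>\<^bsub>M\<^esub> f i else \<zero>\<^bsub>M\<^esub>)"
        using kill fM a(1) by (intro M.finsum_cong') auto
      also have "\<dots> = a \<odot>\<^bsub>M\<^esub> f j"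
        using M.finsum_singleton[of j F "\<lambda>i. a \<odot>\<^bsub>M\<^esub> f i"] j F(1) fM a(1) by auto
      finally have "a \<odot>\<^bsub>M\<^esub> f j \<in> N" using submoduleE(4)[OF N a(1) x] by simp
      moreover have "a \<odot>\<^bsub>M\<^esub> f j \<noteq> \<zero>\<^bsub>M\<^esub>"
        using simple_submodule_Ann_iff[OF K[OF jA] fj False a(1)] a(2) by simp
      moreover have "a \<odot>\<^bsub>M\<^esub> f j \<in> K j" using submoduleE(4)[OF sub[OF jA] a(1) fj] .
      ultimately have "K j \<subseteq> N" using simple_submodule_le[OF K[OF jA] N] by blast
      then have "j \<in> ?B" using jA by blast
      from subsetD[OF submodule_sum_upper[where K = K, OF this KM[OF jA]] fj] show ?thesis .
    qed
    then show "x \<in> submodule_sum M K ?B" unfolding xF using F(1) by (intro submodule_finsum[OF S])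
  qed
qed

lemma semisimple_multiplication_iff:
  assumes ss: "semisimple_module R M" and sr: "second_representable R M (carrier M)"
  shows "multiplication_module R M \<longleftrightarrow>
           (\<forall>p\<in>att_second R M. \<forall>q\<in>att_second R M. p \<noteq> q \<longrightarrow> \<not> p \<subseteq> q) \<and>
           (\<forall>K. second_submodule R M K \<longrightarrow> simple_submodule R M K)"
    (is "_ \<longleftrightarrow> ?inc \<and> ?simple")
proof -
  obtain n K where rep: "minimal_second_representation R M (carrier M) n K"
    using minimal_second_representation_exists[OF sr] by auto
  have K: "\<And>i. i \<in> {1..n} \<Longrightarrow> second_submodule R M (K i)" and M: "carrier M = submodule_sum M K {1..n}"
    and dist: "\<And>i j. i \<in> {1..n} \<Longrightarrow> j \<in> {1..n} \<Longrightarrow> i \<noteq> j \<Longrightarrow> Ann R M (K i) \<noteq> Ann R M (K j)"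
    using rep unfolding minimal_second_representation_def second_representation_def by auto
  note att = att_second_eq[OF rep]
  show ?thesis
  proof
    assume mult: "multiplication_module R M"
    have inc: ?inc
      using multiplication_iff_minimal_representation[OF rep] mult
        incomparable_iff_minimal_elements[of "att_second R M"] by simp
    have "simple_submodule R M L" if L: "second_submodule R M L" for L
    proof -
      obtain S where S: "simple_submodule R M S" "S \<subseteq> L"
        using semisimple_nonzero_contains_simple[OF ss] L unfolding second_submodule_def by blast
      \<comment> \<open>Both \<open>S\<close> and \<open>L\<close> are summands of the minimal representation, and nested summands coincide.\<close>
      obtain i where i: "i \<in> {1..n}" "S = K i"
        using multiplication_second_is_summand[OF mult rep simple_imp_second[OF S(1)]] by auto
      obtain k where k: "k \<in> {1..n}" "L = K k"
        using multiplication_second_is_summand[OF mult rep L] by auto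
      have "Ann R M (K k) \<subseteq> Ann R M (K i)" using S(2) i k Ann_antimono by simp
      then have "k = i" using multiplication_Ann_incomparable[OF mult rep k(1) i(1)] by blast
      then show ?thesis using S i k by simp
    qed
    with inc show "?inc \<and> ?simple" by blast
  next
    assume b: "?inc \<and> ?simple"
    have inc: "\<not> Ann R M (K i) \<subseteq> Ann R M (K j)" if "i \<in> {1..n}" "j \<in> {1..n}" "i \<noteq> j" for i j
    proof -
      have "Ann R M (K i) \<in> att_second R M" "Ann R M (K j) \<in> att_second R M"
        unfolding att using that by auto
      then show ?thesis using b dist[OF that] by simp
    qed
    have simple: "simple_submodule R M (K i)" if "i \<in> {1..n}" for i using b K[OF that] by blast
    show "multiplication_module R M"
    proof (rule incomparable_subsums_imp_multiplication[OF _ K M inc])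
      fix N assume "nonzero_submodule R M N"
      then have "N = submodule_sum M K {j \<in> {1..n}. K j \<subseteq> N}"
        unfolding nonzero_submodule_def
        by (intro simple_incomparable_submodule_eq_subsum[OF _ simple M inc]) auto
      then show "\<exists>B\<subseteq>{1..n}. N = submodule_sum M K B"
        by (intro exI[of _ "{j \<in> {1..n}. K j \<subseteq> N}"]) auto
    qed auto
  qed
qed

section \<open>Atomic modules\<close>

text \<open>
  Here \<open>K\<close> is a vector space over the field \<open>R/p\<close>, and the submodule generated by \<open>x\<close> is a line in it.
\<close>

lemma atomic_homogeneous_cyclic_simple:
  assumes atomic: "atomic_module R M" and K: "submodule K R M"
    and p: "\<And>N. nonzero_submodule R M N \<Longrightarrow> N \<subseteq> K \<Longrightarrow> p_second R M p N"
    and x: "x \<in> K" "x \<noteq> \<zero>\<^bsub>M\<^esub>"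
  shows "simple_submodule R M ((\<lambda>r. r \<odot>\<^bsub>M\<^esub> x) ` carrier R)" (is "simple_submodule R M ?X")
proof -
  have xM: "x \<in> carrier M" using x submoduleE(1)[OF K] by blast
  have Knz: "nonzero_submodule R M K" using K x unfolding nonzero_submodule_def by blast
  have AnnK: "Ann R M K = p" using p[OF Knz] unfolding p_second_def by blast
  obtain S where S: "simple_submodule R M S" "S \<subseteq> K"
    using atomic Knz unfolding atomic_module_def by blast
  have "nonzero_submodule R M S" using S(1) unfolding simple_submodule_def by blast
  then have AnnS: "Ann R M S = p" using p S(2) unfolding p_second_def by blast
  obtain s where s: "s \<in> S" "s \<noteq> \<zero>\<^bsub>M\<^esub>"
    using S(1) submodule_zero_mem unfolding simple_submodule_def nonzero_submodule_def by blast
  have sM: "s \<in> carrier M" using s submoduleE(1)[OF simple_submodule_is_submodule[OF S(1)]] by blast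
  \<comment> \<open>As \<open>S\<close> is simple, \<open>p = Ann S\<close> is maximal: every scalar outside \<open>p\<close> is invertible modulo \<open>p\<close>.\<close>
  have inv: "\<exists>t\<in>carrier R. \<one>\<^bsub>R\<^esub> \<ominus>\<^bsub>R\<^esub> t \<otimes>\<^bsub>R\<^esub> r \<in> p" if r: "r \<in> carrier R" "r \<notin> p" for r
  proof -
    have "r \<odot>\<^bsub>M\<^esub> s \<noteq> \<zero>\<^bsub>M\<^esub>" using simple_submodule_Ann_iff[OF S(1) s r(1)] r(2) AnnS by simp
    moreover have "r \<odot>\<^bsub>M\<^esub> s \<in> S"
      using submoduleE(4)[OF simple_submodule_is_submodule[OF S(1)] r(1) s(1)] .
    ultimately obtain t where t: "t \<in> carrier R" "s = t \<odot>\<^bsub>M\<^esub> (r \<odot>\<^bsub>M\<^esub> s)"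
      using simple_submodule_generated[OF S(1) _ _ s(1)] by blast
    have c: "t \<otimes>\<^bsub>R\<^esub> r \<in> carrier R" using t r by simp
    have trs: "(t \<otimes>\<^bsub>R\<^esub> r) \<odot>\<^bsub>M\<^esub> s = s" using t r sM smult_assoc1 by simp
    have "(\<one>\<^bsub>R\<^esub> \<ominus>\<^bsub>R\<^esub> t \<otimes>\<^bsub>R\<^esub> r) \<odot>\<^bsub>M\<^esub> s = \<one>\<^bsub>R\<^esub> \<odot>\<^bsub>M\<^esub> s \<oplus>\<^bsub>M\<^esub> \<ominus>\<^bsub>M\<^esub> ((t \<otimes>\<^bsub>R\<^esub> r) \<odot>\<^bsub>M\<^esub> s)"
      unfolding R.minus_eq using c sM by (simp only: smult_l_distr smult_l_minus R.one_closed R.a_inv_closed)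
    also have "\<dots> = \<zero>\<^bsub>M\<^esub>" using trs sM by (simp add: M.r_neg)
    finally have "\<one>\<^bsub>R\<^esub> \<ominus>\<^bsub>R\<^esub> t \<otimes>\<^bsub>R\<^esub> r \<in> Ann R M S"
      using simple_submodule_Ann_iff[OF S(1) s, of "\<one>\<^bsub>R\<^esub> \<ominus>\<^bsub>R\<^esub> t \<otimes>\<^bsub>R\<^esub> r"] c by simp
    then show ?thesis using AnnS t(1) by blast
  qed
  have X: "submodule ?X R M" by (rule cyclic_submodule[OF xM])
  show ?thesis unfolding simple_submodule_def
  proof (intro conjI allI impI)
    show "nonzero_submodule R M ?X"
      using X mem_cyclic[OF xM] x(2) unfolding nonzero_submodule_def by blast
    fix N assume N: "nonzero_submodule R M N \<and> N \<subseteq> ?X"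
    then have Nsub: "submodule N R M" unfolding nonzero_submodule_def by blast
    obtain y where y: "y \<in> N" "y \<noteq> \<zero>\<^bsub>M\<^esub>"
      using N submodule_zero_mem[OF Nsub] unfolding nonzero_submodule_def by blast
    obtain r where r: "r \<in> carrier R" "y = r \<odot>\<^bsub>M\<^esub> x" using y(1) N by blast
    have "r \<notin> p" using y(2) r x(1) AnnK unfolding Ann_def by auto
    then obtain t where t: "t \<in> carrier R" "\<one>\<^bsub>R\<^esub> \<ominus>\<^bsub>R\<^esub> t \<otimes>\<^bsub>R\<^esub> r \<in> p" using inv r(1) by blast
    have c: "t \<otimes>\<^bsub>R\<^esub> r \<in> carrier R" using t r by simp
    have "\<zero>\<^bsub>M\<^esub> = (\<one>\<^bsub>R\<^esub> \<ominus>\<^bsub>R\<^esub> t \<otimes>\<^bsub>R\<^esub> r) \<odot>\<^bsub>M\<^esub> x" using t(2) x(1) AnnK unfolding Ann_def by auto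
    also have "\<dots> = \<one>\<^bsub>R\<^esub> \<odot>\<^bsub>M\<^esub> x \<oplus>\<^bsub>M\<^esub> \<ominus>\<^bsub>M\<^esub> ((t \<otimes>\<^bsub>R\<^esub> r) \<odot>\<^bsub>M\<^esub> x)"
      unfolding R.minus_eq using c xM by (simp only: smult_l_distr smult_l_minus R.one_closed R.a_inv_closed)
    finally have "x \<ominus>\<^bsub>M\<^esub> (t \<otimes>\<^bsub>R\<^esub> r) \<odot>\<^bsub>M\<^esub> x = \<zero>\<^bsub>M\<^esub>" using xM by (simp add: M.minus_eq)
    then have "x = (t \<otimes>\<^bsub>R\<^esub> r) \<odot>\<^bsub>M\<^esub> x" using diff_zero_imp_eq[OF xM] xM c by simp
    then have "x = t \<odot>\<^bsub>M\<^esub> y" using t r xM smult_assoc1 by simp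
    then have "x \<in> N" using submoduleE(4)[OF Nsub t(1) y(1)] by simp
    then have "?X \<subseteq> N" using submoduleE(4)[OF Nsub] by auto
    then show "N = ?X" using N by blast
  qed
qed

lemma semisimple_imp_homogeneous_sum:
  assumes "semisimple_module R M"
  shows "\<exists>(A :: 'c set set) K p.
    (\<forall>i\<in>A. submodule (K i) R M \<and> primeideal (p i) R \<and>
       (\<forall>N. nonzero_submodule R M N \<and> N \<subseteq> K i \<longrightarrow> p_second R M (p i) N)) \<and>
    carrier M = submodule_sum M K A"
proof -
  obtain \<S> where simple: "\<And>S. S \<in> \<S> \<Longrightarrow> simple_submodule R M S"
    and M: "carrier M = submodule_sum M (\<lambda>S. S) \<S>"
    using assms unfolding semisimple_module_def by blast
  have "submodule S R M \<and> primeideal (Ann R M S) R \<and>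
      (\<forall>N. nonzero_submodule R M N \<and> N \<subseteq> S \<longrightarrow> p_second R M (Ann R M S) N)" if "S \<in> \<S>" for S
    using simple[OF that] simple_imp_second[OF simple[OF that]] simple_submodule_is_submodule
      Ann_second_prime unfolding simple_submodule_def p_second_def by metis
  then show ?thesis using M
    by (intro exI[of _ \<S>] exI[of _ "\<lambda>S. S"] exI[of _ "Ann R M"]) auto
qed

lemma atomic_homogeneous_sum_imp_semisimple:
  assumes atomic: "atomic_module R M" and K: "\<And>i. i \<in> A \<Longrightarrow> submodule (K i) R M"
    and p: "\<And>i N. i \<in> A \<Longrightarrow> nonzero_submodule R M N \<Longrightarrow> N \<subseteq> K i \<Longrightarrow> p_second R M (p i) N"
    and M: "carrier M = submodule_sum M K A"
  shows "semisimple_module R M"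
proof -
  let ?\<S> = "{S. simple_submodule R M S}"
  let ?T = "submodule_sum M (\<lambda>S. S) ?\<S>"
  have T: "submodule ?T R M" using simple_submodule_is_submodule by (intro submodule_sum_submodule) auto
  have "K i \<subseteq> ?T" if i: "i \<in> A" for i
  proof
    fix x assume x: "x \<in> K i"
    show "x \<in> ?T"
    proof (cases "x = \<zero>\<^bsub>M\<^esub>")
      case True
      then show ?thesis using submodule_zero_mem[OF T] by simp
    next
      case False
      let ?X = "(\<lambda>r. r \<odot>\<^bsub>M\<^esub> x) ` carrier R"
      have xM: "x \<in> carrier M" using x submoduleE(1)[OF K[OF i]] by blast
      have "simple_submodule R M ?X"
        by (rule atomic_homogeneous_cyclic_simple[OF atomic K[OF i] p[OF i] x False])
      then have "?X \<subseteq> ?T"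
        using submoduleE(1)[OF cyclic_submodule[OF xM]]
        by (intro submodule_sum_upper[where K = "\<lambda>S. S"]) auto
      then show ?thesis using mem_cyclic[OF xM] by blast
    qed
  qed
  then have "carrier M \<subseteq> ?T" unfolding M by (rule submodule_sum_least[OF T])
  then have "carrier M = ?T" using submoduleE(1)[OF T] by blast
  then show ?thesis unfolding semisimple_module_def by (intro exI[of _ ?\<S>]) auto
qed

end

theorem theorem3p10:
  fixes R :: "('a, 'c) ring_scheme" and M :: "('a, 'b, 'd) module_scheme"
  assumes "module R M"
    and "carrier M \<noteq> {\<zero>\<^bsub>M\<^esub>}"
  shows
    "(multiplication_module R M \<longrightarrow>
        (semisecond R M (carrier M) \<longleftrightarrow>
           (\<forall>N. nonzero_submodule R M N \<longrightarrow> semisecond R M N)) \<and>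
        (second_representable R M (carrier M) \<longleftrightarrow>
           (\<forall>N. nonzero_submodule R M N \<longrightarrow> second_representable R M N)))
   \<and> (multiplication_module R M \<and> \<not> hollow_module R M \<longrightarrow>
        (semisecond R M (carrier M) \<longleftrightarrow>
           (\<forall>N. proper_submodule R M N \<and> \<not> small_submodule R M N \<longrightarrow> semisecond R M N)) \<and>
        (second_representable R M (carrier M) \<longleftrightarrow>
           (\<forall>N. proper_submodule R M N \<and> \<not> small_submodule R M N \<longrightarrow> second_representable R M N)))
   \<and> (\<forall>n K. minimal_second_representation R M (carrier M) n K \<longrightarrow>
        (multiplication_module R M \<longleftrightarrow>
           Att_second R M = att_second R M \<and>
           att_second R M = minimal_elements (att_second R M) \<and>
           (\<forall>N. nonzero_submodule R M N \<longrightarrow>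
              (\<exists>A. A \<subseteq> {1..n} \<and> N = submodule_sum M K A))))
   \<and> (semisimple_module R M \<and> second_representable R M (carrier M) \<longrightarrow>
        (multiplication_module R M \<longleftrightarrow>
           (\<forall>p\<in>att_second R M. \<forall>q\<in>att_second R M. p \<noteq> q \<longrightarrow> \<not> p \<subseteq> q) \<and>
           (\<forall>K. second_submodule R M K \<longrightarrow> simple_submodule R M K)))
   \<and> (atomic_module R M \<longrightarrow>
        (semisimple_module R M \<longleftrightarrow>
           (\<exists>(A :: 'b set set) (K :: 'b set \<Rightarrow> 'b set) (p :: 'b set \<Rightarrow> 'a set).
              (\<forall>i\<in>A. submodule (K i) R M \<and> primeideal (p i) R \<and>
                 (\<forall>N. nonzero_submodule R M N \<and> N \<subseteq> K i \<longrightarrow> p_second R M (p i) N)) \<and>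
              carrier M = submodule_sum M K A)))"
proof -
  interpret module R M by (rule assms(1))
  have M: "submodule (carrier M) R M" "nonzero_submodule R M (carrier M)"
    using carrier_is_submodule assms(2) unfolding nonzero_submodule_def by auto
  show ?thesis
  proof (intro conjI impI allI)
    assume mult: "multiplication_module R M"
    show "semisecond R M (carrier M) \<longleftrightarrow>
        (\<forall>N. nonzero_submodule R M N \<longrightarrow> semisecond R M N)"
      using multiplication_imp_submodule_semisecond[OF mult] M(2)
      unfolding nonzero_submodule_def by auto
    show "second_representable R M (carrier M) \<longleftrightarrow>
        (\<forall>N. nonzero_submodule R M N \<longrightarrow> second_representable R M N)"
      using multiplication_imp_submodule_second_representable[OF mult] M(2)
      unfolding nonzero_submodule_def by auto
  next
    assume "multiplication_module R M \<and> \<not> hollow_module R M"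
    then have mult: "multiplication_module R M" and nh: "\<not> hollow_module R M" by auto
    show "semisecond R M (carrier M) \<longleftrightarrow>
        (\<forall>N. proper_submodule R M N \<and> \<not> small_submodule R M N \<longrightarrow> semisecond R M N)"
    proof (intro iffI allI impI)
      fix N assume "semisecond R M (carrier M)" "proper_submodule R M N \<and> \<not> small_submodule R M N"
      then show "semisecond R M N"
        unfolding proper_submodule_def using multiplication_imp_submodule_semisecond[OF mult] by simp
    qed (rule not_hollow_semisecond[OF nh], blast)
    show "second_representable R M (carrier M) \<longleftrightarrow>
        (\<forall>N. proper_submodule R M N \<and> \<not> small_submodule R M N \<longrightarrow> second_representable R M N)"
    proof (intro iffI allI impI)
      fix N assume "second_representable R M (carrier M)" "proper_submodule R M N \<and> \<not> small_submodule R M N"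
      then show "second_representable R M N"
        unfolding proper_submodule_def using multiplication_imp_submodule_second_representable[OF mult] by simp
    qed (rule not_hollow_second_representable[OF nh], blast)
  next
    fix n K assume "minimal_second_representation R M (carrier M) n K"
    then show "multiplication_module R M \<longleftrightarrow>
        Att_second R M = att_second R M \<and>
        att_second R M = minimal_elements (att_second R M) \<and>
        (\<forall>N. nonzero_submodule R M N \<longrightarrow> (\<exists>A. A \<subseteq> {1..n} \<and> N = submodule_sum M K A))"
      by (rule multiplication_iff_minimal_representation)
  next
    assume "semisimple_module R M \<and> second_representable R M (carrier M)"
    then show "multiplication_module R M \<longleftrightarrow>
        (\<forall>p\<in>att_second R M. \<forall>q\<in>att_second R M. p \<noteq> q \<longrightarrow> \<not> p \<subseteq> q) \<and>
        (\<forall>K. second_submodule R M K \<longrightarrow> simple_submodule R M K)"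
      by (intro semisimple_multiplication_iff) auto
  next
    assume atomic: "atomic_module R M"
    show "semisimple_module R M \<longleftrightarrow>
           (\<exists>(A :: 'b set set) (K :: 'b set \<Rightarrow> 'b set) (p :: 'b set \<Rightarrow> 'a set).
              (\<forall>i\<in>A. submodule (K i) R M \<and> primeideal (p i) R \<and>
                 (\<forall>N. nonzero_submodule R M N \<and> N \<subseteq> K i \<longrightarrow> p_second R M (p i) N)) \<and>
              carrier M = submodule_sum M K A)" (is "_ \<longleftrightarrow> ?hom")
    proof
      show ?hom if "semisimple_module R M" using semisimple_imp_homogeneous_sum[OF that] .
    next
      assume ?hom
      then obtain A :: "'b set set" and K :: "'b set \<Rightarrow> 'b set" and p :: "'b set \<Rightarrow> 'a set"
        where K: "\<forall>i\<in>A. submodule (K i) R M \<and> primeideal (p i) R \<and>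
            (\<forall>N. nonzero_submodule R M N \<and> N \<subseteq> K i \<longrightarrow> p_second R M (p i) N)"
          and sum: "carrier M = submodule_sum M K A" by (elim exE conjE)
      show "semisimple_module R M"
        by (rule atomic_homogeneous_sum_imp_semisimple[where K = K and A = A and p = p, OF atomic])
           (use K sum in auto)
    qed
  qed
qed

end
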